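(* Assume that the arrival processes are Poisson with rates $\lambda_i^n$, $i\in\mathcal{I}$, and suppose $\liminf_{n\to\infty}\gamma_i^n>0$ for all $i\in\mathcal{I}$. Let $$\theta^n=1\wedge\frac{(1-\beta^n_{\min})\vee\frac12}{\beta^n_{\max}},\qquad\beta_i^n=\frac{\gamma_i^n}{\mu_i^n}.$$ Then for each $\eta>0$ there exist positive constants $\breve\kappa_0(\eta)$ and $\breve\kappa_1(\eta)$ such that the function $$\breve V^n(\hat x)=\exp\bigl(\eta\theta^n\Psi(-\hat x)+\eta\Psi(\hat x)\bigr)$$ satisfies $$\widehat{\mathscr{A}}^n_z\breve V^n(\hat x)\le\breve\kappa_0(\eta)-\breve\kappa_1(\eta)\|\hat x\|_1\breve V^n(\hat x)\qquad\forall\,\hat x\in\mathscr{X}^n,\ \forall\,z\in\mathcal{Z}^n(\hat x),$$ for all sufficiently large $n$. In particular, the function $\exp(\eta\|\hat x\|_1)$ is integrable under the stationary distribution of $\{\hat X^n(t)\}_{t\ge0}$ for all $\eta>0$ (for all sufficiently large $n$), under any work-conserving stationary Markov scheduling policy.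
   Context: Model. $\mathcal{I}=\{1,\dots,m\}$ customer classes, $n$ servers; $e_i$ is the $i$-th unit vector, $a\wedge b=\min$, $a\vee b=\max$, $\|x\|_1=\sum_i|x_i|$; subscripts $\max,\min$ are the maximum and minimum over $i\in\mathcal{I}$. Class-$i$ customers arrive according to a Poisson process of rate $\lambda_i^n$; service and patience times are exponential with rates $\mu_i^n>0$, $\gamma_i^n\ge0$; all mutually independent. As $n\to\infty$: $\lambda_i^n/n\to\lambda_i>0$, $\mu_i^n\to\mu_i>0$, $\gamma_i^n\to\gamma_i\ge0$, $(\lambda_i^n-n\lambda_i)/\sqrt n$ and $\sqrt n(\mu_i^n-\mu_i)$ converge, $\lambda_i^n/(n\mu_i^n)\to\rho_i=\lambda_i/\mu_i<1$, $\sum_i\rho_i=1$. Put $\varrho^n=\sqrt n\,(1-\sum_i\lambda_i^n/(n\mu_i^n))$. State. $X_i^n(t)$ is the number of class-$i$ customers in system, $Z_i^n(t)$ the number in service. Scheduling is preemptive; $\mathcal{Z}^n(x)=\{z\in\mathbb{Z}_+^m: z_i\le x_i,\ \|z\|_1=n\wedge\|x\|_1\}$ (work conservation). A work-conserving stationary Markov policy is $Z^n(t)=z(X^n(t))$ with $z(x)\in\mathcal{Z}^n(x)$. With $q_i(x,z)=x_i-z_i$, under such a policy $X^n$ is Markov with extended generator $$\mathscr{A}^n_zf(x)=\sum_i\lambda_i^n\bigl(f(x+e_i)-f(x)\bigr)+\sum_i\bigl(\mu_i^nz_i+\gamma_i^nq_i(x,z)\bigr)\bigl(f(x-e_i)-f(x)\bigr).$$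 Scaling: $\hat x_i=\hat x_i^n(x)=\frac1{\sqrt n}(x_i-\frac{\lambda_i^n}{\mu_i^n})-\frac{\varrho^n}{m}$, $\hat X^n(t)=\hat x^n(X^n(t))$; $\mathscr{X}^n=\hat x^n(\mathbb{Z}_+^m)$; $\mathcal{Z}^n(\hat x)$ denotes $\mathcal{Z}^n(x)$ for $\hat x=\hat x^n(x)$; $\widehat{\mathscr{A}}^n_zf(\hat x^n(x))=\mathscr{A}^n_z[f\circ\hat x^n](x)$. Functions. $\psi(t)=-\frac12$ for $t\le-1$, $\psi(t)=(t+1)^3-\frac12(t+1)^4-\frac12$ on $[-1,0]$, $\psi(t)=t$ for $t\ge0$; $\Psi(y)=\sum_{i\in\mathcal{I}}\psi(y_i)/\mu_i$. *)

theory Defs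
  imports "HOL-Probability.Probability"
begin

text \<open>
  The class index set is a finite type 'm.  At level n, the vectors l, u, g hold the
  arrival, service and patience rates.
\<close>

definition norm1 :: "real ^ 'm \<Rightarrow> real" where
  "norm1 y = (\<Sum>i\<in>UNIV. \<bar>y $ i\<bar>)"

definition wc_actions :: "nat \<Rightarrow> nat ^ 'm \<Rightarrow> (nat ^ 'm) set" where
  "wc_actions n x =
     {z. (\<forall>i. z $ i \<le> x $ i) \<and> (\<Sum>i\<in>UNIV. z $ i) = min n (\<Sum>i\<in>UNIV. x $ i)}"

definition wc_policy :: "nat \<Rightarrow> (nat ^ 'm \<Rightarrow> nat ^ 'm) \<Rightarrow> bool" where
  "wc_policy n z \<longleftrightarrow> (\<forall>x. z x \<in> wc_actions n x)"

text \<open>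
  Subtraction in \<open>x - axis i 1\<close> is truncated, but for z in \<open>wc_actions n x\<close> the departure
  rate of class i vanishes when \<open>x $ i = 0\<close>, so such terms contribute nothing.
\<close>

definition generator ::
  "real ^ 'm \<Rightarrow> real ^ 'm \<Rightarrow> real ^ 'm \<Rightarrow> nat ^ 'm \<Rightarrow> (nat ^ 'm \<Rightarrow> real) \<Rightarrow> nat ^ 'm \<Rightarrow> real" where
  "generator l u g z f x =
     (\<Sum>i\<in>UNIV. l $ i * (f (x + axis i 1) - f x)) +
     (\<Sum>i\<in>UNIV. (u $ i * real (z $ i) + g $ i * (real (x $ i) - real (z $ i))) *
                (f (x - axis i 1) - f x))"

definition varrho :: "nat \<Rightarrow> real ^ 'm \<Rightarrow> real ^ 'm \<Rightarrow> real" where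
  "varrho n l u = sqrt (real n) * (1 - (\<Sum>i\<in>UNIV. l $ i / (real n * u $ i)))"

definition xhat :: "nat \<Rightarrow> real ^ 'm \<Rightarrow> real ^ 'm \<Rightarrow> nat ^ 'm \<Rightarrow> real ^ 'm" where
  "xhat n l u x =
     (\<chi> i. (real (x $ i) - l $ i / u $ i) / sqrt (real n) - varrho n l u / real CARD('m))"

definition scaled_states :: "nat \<Rightarrow> real ^ 'm \<Rightarrow> real ^ 'm \<Rightarrow> (real ^ 'm) set" where
  "scaled_states n l u = range (xhat n l u)"

text \<open>
  For positive n the map \<open>xhat n l u\<close> is injective, so actions and generator can be
  transported to scaled states through its inverse; see the lemmas below.
\<close>

definition scaled_wc_actions ::
  "nat \<Rightarrow> real ^ 'm \<Rightarrow> real ^ 'm \<Rightarrow> real ^ 'm \<Rightarrow> (nat ^ 'm) set" where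
  "scaled_wc_actions n l u y = wc_actions n (inv (xhat n l u) y)"

definition scaled_generator ::
  "nat \<Rightarrow> real ^ 'm \<Rightarrow> real ^ 'm \<Rightarrow> real ^ 'm \<Rightarrow> nat ^ 'm \<Rightarrow> (real ^ 'm \<Rightarrow> real) \<Rightarrow> real ^ 'm \<Rightarrow> real" where
  "scaled_generator n l u g z f y =
     generator l u g z (f \<circ> xhat n l u) (inv (xhat n l u) y)"

lemma inj_xhat: "0 < n \<Longrightarrow> inj (xhat n l u)"
  by (auto simp: inj_def xhat_def vec_eq_iff)

lemma scaled_wc_actions_xhat:
  "0 < n \<Longrightarrow> scaled_wc_actions n l u (xhat n l u x) = wc_actions n x"
  by (simp add: scaled_wc_actions_def inj_xhat)

lemma scaled_generator_xhat:
  "0 < n \<Longrightarrow>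
     scaled_generator n l u g z f (xhat n l u x) = generator l u g z (f \<circ> xhat n l u) x"
  by (simp add: scaled_generator_def inj_xhat)

definition psi :: "real \<Rightarrow> real" where
  "psi t = (if t \<le> - 1 then - 1 / 2
            else if t \<le> 0 then (t + 1) ^ 3 - (t + 1) ^ 4 / 2 - 1 / 2
            else t)"

text \<open>In \<open>Psi\<close> the argument m0 is the vector of limiting service rates.\<close>

definition Psi :: "real ^ 'm \<Rightarrow> real ^ 'm \<Rightarrow> real" where
  "Psi m0 y = (\<Sum>i\<in>UNIV. psi (y $ i) / m0 $ i)"

definition beta :: "real ^ 'm \<Rightarrow> real ^ 'm \<Rightarrow> 'm \<Rightarrow> real" where
  "beta u g i = g $ i / u $ i"

definition theta :: "real ^ 'm \<Rightarrow> real ^ 'm \<Rightarrow> real" where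
  "theta u g = min 1 (max (1 - Min (range (beta u g))) (1 / 2) / Max (range (beta u g)))"

definition lyapunov :: "real ^ 'm \<Rightarrow> real ^ 'm \<Rightarrow> real ^ 'm \<Rightarrow> real \<Rightarrow> real ^ 'm \<Rightarrow> real" where
  "lyapunov m0 u g \<eta> y = exp (\<eta> * theta u g * Psi m0 (- y) + \<eta> * Psi m0 y)"

text \<open>
  Feller's construction of the (minimal) transition function of a continuous-time Markov
  chain with Q-matrix q: \<open>feller_iter q k t x y\<close> is the probability that the chain started
  at x is at y at time t after at most k jumps, obtained by conditioning on the first jump.
\<close>

primrec feller_iter :: "('s \<Rightarrow> 's \<Rightarrow> real) \<Rightarrow> nat \<Rightarrow> real \<Rightarrow> 's \<Rightarrow> 's \<Rightarrow> ennreal" where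
  "feller_iter q 0 t x y = (if x = y then ennreal (exp (q x x * t)) else 0)"
| "feller_iter q (Suc k) t x y =
     (if x = y then ennreal (exp (q x x * t)) else 0) +
     (\<integral>\<^sup>+ s\<in>{0..t}. ennreal (exp (q x x * s)) *
        (\<integral>\<^sup>+ w. ennreal (q x w) * feller_iter q k (t - s) w y \<partial>count_space (- {x})) \<partial>lborel)"

definition transition :: "('s \<Rightarrow> 's \<Rightarrow> real) \<Rightarrow> real \<Rightarrow> 's \<Rightarrow> 's \<Rightarrow> ennreal" where
  "transition q t x y = (SUP k. feller_iter q k t x y)"

definition stationary :: "('s \<Rightarrow> 's \<Rightarrow> real) \<Rightarrow> 's pmf \<Rightarrow> bool" where
  "stationary q \<pi> \<longleftrightarrow>
     (\<forall>t\<ge>0. \<forall>y. (\<integral>\<^sup>+ x. transition q t x y \<partial>measure_pmf \<pi>) = ennreal (pmf \<pi> y))"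

text \<open>
  The Q-matrix of the queueing process under policy z: its (x, y) entry is the generator
  applied to the indicator of y, evaluated at x.
\<close>

definition policy_rates ::
  "real ^ 'm \<Rightarrow> real ^ 'm \<Rightarrow> real ^ 'm \<Rightarrow> (nat ^ 'm \<Rightarrow> nat ^ 'm) \<Rightarrow> nat ^ 'm \<Rightarrow> nat ^ 'm \<Rightarrow> real" where
  "policy_rates l u g z x y = generator l u g (z x) (indicator {y}) x"

end

theory Submission
  imports Defs
begin

text \<open>
  Drift inequality.  The logarithm of the Lyapunov function is a separable function with coordinate
  profile \<open>phi \<theta> t = \<theta> * psi (- t) + psi t\<close>, whose slope is 1 far to the right, \<open>- \<theta>\<close> far to the
  left, and between \<open>- \<theta>\<close> and 1 everywhere.  A second-order expansion of the generator leaves, up to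
  bounded terms and a small multiple of \<open>norm1 y\<close>, the sum of
  \<open>dphi \<theta> (y i) * (- y i + (1 - \<beta> i) * q i)\<close>, where \<open>q\<close> is the scaled queue.  Work conservation
  makes the total queue equal to the positive part of \<open>\<Sum>i. y i\<close>, and the choice of \<open>\<theta>\<close> keeps each
  factor \<open>dphi \<theta> (y i) * (1 - \<beta> i)\<close> below a constant less than 1, so the restoring drift wins.

  Stationary law.  Feller's transition function is the minimal nonnegative solution of the backward
  equation, so supersolutions bound it.  A linear supersolution bounds the expected number of jumps
  and excludes explosion; mass conservation turns the subsemigroup inequality from minimality into
  the semigroup law.  At a fixed level the function \<open>exp (a * head_count x)\<close> has generator at most
  \<open>K - exp (a * head_count x)\<close> for every \<open>a > 0\<close>, since every customer leaves at a rate bounded below.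
  This gives tightness of the time-1 Cesaro averages, hence existence, and integrability of all
  exponentials; uniqueness follows because the empty state is reached from everywhere.
\<close>

section \<open>Feller transition functions\<close>

text \<open>The drift inequality cannot yield the integrability claim directly. Its threshold in the
  level depends on \<eta>, because the jumps of the exponent must be small and the second-order
  error must fit into the decay, whereas the claim on stationary laws asks for one threshold serving
  every \<eta>. Hence a second test function, in the head count, used at a fixed level where
  constants may depend on \<open>n\<close>. The weights \<open>1 / mu0 $ i\<close> in
  \<open>Psi\<close> cancel the service rates, so all classes restore with equal strength and their
  queues can be added before work conservation is applied. The weights are limits while the rates
  belong to level \<open>n\<close>; the remaining ratio is close to 1 and its error is charged to
  the decay. Since \<open>stationary\<close> refers to the Feller iterates and not to the generator,
  every fact about the chain must be extracted from the integral form of the backward equation. The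
  test functions are unbounded, so the arguments use one-sided inequalities in
  \<open>ennreal\<close>, which need no prior integrability; equalities are recovered by counting
  mass.\<close>

locale conservative_rates =
  fixes q :: "'s::countable \<Rightarrow> 's \<Rightarrow> real"
  assumes row_sum: "\<And>x. (\<integral>\<^sup>+ w. ennreal (q x w) \<partial>count_space (- {x})) = ennreal (- q x x)"
    and diag_nonpos: "\<And>x. q x x \<le> 0"
begin

definition jump :: "('s \<Rightarrow> ennreal) \<Rightarrow> 's \<Rightarrow> ennreal" where
  "jump f x = (\<integral>\<^sup>+ w. ennreal (q x w) * f w \<partial>count_space (- {x}))"

definition first_jump :: "(real \<Rightarrow> 's \<Rightarrow> ennreal) \<Rightarrow> real \<Rightarrow> 's \<Rightarrow> ennreal" where
  "first_jump f t x =
     (\<integral>\<^sup>+ s\<in>{0..t}. ennreal (exp (q x x * s)) * jump (f (t - s)) x \<partial>lborel)"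

text \<open>States are discrete and countable, so joint measurability reduces to measurability in
  time for each state.\<close>

definition time_measurable :: "(real \<Rightarrow> 's \<Rightarrow> ennreal) \<Rightarrow> bool" where
  "time_measurable f \<longleftrightarrow> (\<forall>x. (\<lambda>t. f t x) \<in> borel_measurable borel)"

lemma jump_mono: "(\<And>w. f w \<le> g w) \<Longrightarrow> jump f x \<le> jump g x"
  unfolding jump_def by (intro nn_integral_mono mult_left_mono) auto

lemma jump_add: "jump (\<lambda>w. f w + g w) x = jump f x + jump g x"
  unfolding jump_def by (simp add: distrib_left nn_integral_add)

lemma jump_const: "jump (\<lambda>w. c) x = ennreal (- q x x) * c"
  unfolding jump_def using row_sum[of x] by (simp add: nn_integral_multc)

lemma jump_measurable:
  assumes "\<And>w. (\<lambda>t. f t w) \<in> borel_measurable M"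
  shows "(\<lambda>t. jump (f t) x) \<in> borel_measurable M"
proof -
  interpret sigma_finite_measure "count_space (- {x}) :: 's measure"
    by (rule sigma_finite_measure_count_space_countable) auto
  note [measurable] = assms
  have "(\<lambda>(w, t). ennreal (q x w) * f t w) \<in> borel_measurable (count_space (- {x}) \<Otimes>\<^sub>M M)"
    by (rule measurable_pair_measure_countable1) simp_all
  from measurable_pair_swap[OF this]
  show ?thesis unfolding jump_def by (intro borel_measurable_nn_integral) simp
qed

lemma first_jump_measurable:
  assumes "time_measurable f"
  shows "time_measurable (first_jump f)"
  unfolding time_measurable_def
proof
  fix x
  have [measurable]: "\<And>w. (\<lambda>t. f t w) \<in> borel_measurable borel"
    using assms by (simp add: time_measurable_def)
  have [measurable]: "(\<lambda>t. jump (f t) x) \<in> borel_measurable borel"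
    by (rule jump_measurable) measurable
  have [measurable]: "(\<lambda>z. jump (f (fst z - snd z)) x) \<in> borel_measurable (borel \<Otimes>\<^sub>M lborel)"
    by (rule measurable_compose[where g = "\<lambda>t. jump (f t) x"]) measurable
  \<comment> \<open>The moving interval of integration becomes a fixed measurable subset of the
    plane, so measurability in the parameter \<open>t\<close> follows from Tonelli.\<close>
  have "(\<lambda>(t, s). ennreal (exp (q x x * s)) * jump (f (t - s)) x * indicator {0..t} s)
      = (\<lambda>z. ennreal (exp (q x x * snd z)) * jump (f (fst z - snd z)) x *
            indicator {z. 0 \<le> snd z \<and> snd z \<le> fst z} z)"
    by (auto simp: fun_eq_iff indicator_def)
  also have "\<dots> \<in> borel_measurable (borel \<Otimes>\<^sub>M lborel)"
    by measurable
  finally show "(\<lambda>t. first_jump f t x) \<in> borel_measurable borel"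
    unfolding first_jump_def by (rule lborel.borel_measurable_nn_integral)
qed

lemma first_jump_mono:
  assumes "\<And>s w. 0 \<le> s \<Longrightarrow> s \<le> t \<Longrightarrow> f s w \<le> g s w"
  shows "first_jump f t x \<le> first_jump g t x"
  unfolding first_jump_def
  by (intro nn_integral_mono)
     (auto simp: indicator_def intro!: mult_left_mono jump_mono assms)

lemma jump_shift_measurable:
  assumes "time_measurable f"
  shows "(\<lambda>s. jump (f (t - s)) x) \<in> borel_measurable borel"
proof (rule jump_measurable)
  fix w
  have [measurable]: "(\<lambda>t. f t w) \<in> borel_measurable borel"
    using assms by (simp add: time_measurable_def)
  show "(\<lambda>s. f (t - s) w) \<in> borel_measurable borel"
    by measurable
qed

lemma first_jump_add:
  assumes "time_measurable f" "time_measurable g"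
  shows "first_jump (\<lambda>t x. f t x + g t x) t x = first_jump f t x + first_jump g t x"
proof -
  note [measurable] = jump_shift_measurable[OF assms(1)] jump_shift_measurable[OF assms(2)]
  show ?thesis
    unfolding first_jump_def jump_add distrib_left distrib_right
    by (rule nn_integral_add) measurable
qed

lemma first_jump_SUP:
  assumes meas: "\<And>k::nat. time_measurable (f k)"
    and inc: "\<And>s w. incseq (\<lambda>k. f k s w)"
  shows "first_jump (\<lambda>t x. SUP k. f k t x) t x = (SUP k. first_jump (f k) t x)"
proof -
  have j: "jump (\<lambda>w. SUP k. f k s w) x = (SUP k. jump (f k s) x)" for s
    unfolding jump_def SUP_mult_left_ennreal
    using inc by (intro nn_integral_monotone_convergence_SUP)
      (auto simp: incseq_def le_fun_def intro!: mult_left_mono)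
  have jinc: "incseq (\<lambda>k. jump (f k s) x)" for s
    using inc by (auto simp: incseq_def intro!: jump_mono)
  note [measurable] = jump_shift_measurable[OF meas]
  show ?thesis
    unfolding first_jump_def j SUP_mult_left_ennreal SUP_mult_right_ennreal
    using jinc by (intro nn_integral_monotone_convergence_SUP)
      (auto simp: incseq_def le_fun_def intro!: mult_left_mono mult_right_mono)
qed

lemma first_jump_nn_integral:
  fixes f :: "'a::countable \<Rightarrow> real \<Rightarrow> 's \<Rightarrow> ennreal"
  assumes meas: "\<And>y. time_measurable (f y)"
  shows "first_jump (\<lambda>t x. \<integral>\<^sup>+ y. f y t x \<partial>count_space UNIV) t x
    = (\<integral>\<^sup>+ y. first_jump (f y) t x \<partial>count_space UNIV)"
proof -
  have j: "jump (\<lambda>w. \<integral>\<^sup>+ y. f y s w \<partial>count_space UNIV) x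
      = (\<integral>\<^sup>+ y. jump (f y s) x \<partial>count_space UNIV)" for s
    unfolding jump_def
    by (subst nn_integral_cmult[symmetric], simp,
        rule nn_integral_count_space_nn_integral) auto
  note [measurable] = jump_shift_measurable[OF meas]
  show ?thesis
    unfolding first_jump_def j
    by (subst nn_integral_cmult[symmetric], simp,
        subst nn_integral_multc[symmetric], simp,
        rule nn_integral_count_space_nn_integral) auto
qed

text \<open>The exponential holding time has density \<open>- q x x * exp (q x x * s)\<close>;
  either no jump occurs by time \<open>t\<close> or a first one does.\<close>

lemma first_jump_one:
  assumes "0 \<le> t"
  shows "ennreal (exp (q x x * t)) + first_jump (\<lambda>t x. 1) t x = 1"
proof -
  have "first_jump (\<lambda>t x. 1) t x
      = (\<integral>\<^sup>+ s. ennreal (- q x x * exp (q x x * s)) * indicator {0..t} s \<partial>lborel)"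
    unfolding first_jump_def jump_const using diag_nonpos[of x]
    by (intro nn_integral_cong)
       (simp add: ennreal_mult[symmetric] mult_ac del: mult_minus_left mult_minus_right)
  also have "\<dots> = ennreal (- exp (q x x * t) - - exp (q x x * 0))"
    using diag_nonpos[of x]
    by (intro nn_integral_FTC_Icc assms)
       (auto intro!: derivative_eq_intros mult_nonpos_nonneg)
  finally show ?thesis
    using diag_nonpos[of x] assms
    by (simp add: ennreal_plus[symmetric] mult_nonpos_nonneg del: ennreal_plus)
qed

lemma feller_iter_Suc:
  "feller_iter q (Suc k) t x y =
     feller_iter q 0 t x y + first_jump (\<lambda>t x. feller_iter q k t x y) t x"
  by (simp add: first_jump_def jump_def)

declare feller_iter.simps(2) [simp del]

lemma feller_iter_measurable: "time_measurable (\<lambda>t x. feller_iter q k t x y)"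
proof (induction k)
  case 0
  show ?case by (simp add: time_measurable_def)
next
  case (Suc k)
  have "time_measurable (first_jump (\<lambda>t x. feller_iter q k t x y))"
    by (rule first_jump_measurable[OF Suc])
  then have [measurable]: "(\<lambda>t. first_jump (\<lambda>t x. feller_iter q k t x y) t x) \<in> borel_measurable borel" for x
    by (simp add: time_measurable_def)
  show ?case unfolding feller_iter_Suc time_measurable_def by simp
qed

lemma feller_iter_mono: "feller_iter q k t x y \<le> feller_iter q (Suc k) t x y"
proof (induction k arbitrary: t x)
  case 0
  show ?case by (simp add: feller_iter_Suc)
next
  case (Suc k)
  show ?case unfolding feller_iter_Suc[of "Suc k"]
    by (subst feller_iter_Suc) (intro add_left_mono first_jump_mono Suc)
qed

lemma incseq_feller_iter: "incseq (\<lambda>k. feller_iter q k t x y)"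
  by (rule incseq_SucI) (rule feller_iter_mono)

lemma transition_measurable: "time_measurable (\<lambda>t x. transition q t x y)"
proof -
  have [measurable]: "(\<lambda>t. feller_iter q k t x y) \<in> borel_measurable borel" for k x
    using feller_iter_measurable by (simp add: time_measurable_def)
  show ?thesis unfolding transition_def time_measurable_def by measurable
qed

text \<open>The iterates increase in \<open>k\<close>, so monotone convergence carries the recursion
  to its supremum: the transition function solves the backward equation in integral form.\<close>

lemma transition_backward:
  "transition q t x y = feller_iter q 0 t x y + first_jump (\<lambda>t x. transition q t x y) t x"
proof -
  have "transition q t x y = (SUP k. feller_iter q (Suc k) t x y)"
    unfolding transition_def
    by (intro antisym SUP_mono)
       (use feller_iter_mono in blast)+
  also have "\<dots> = feller_iter q 0 t x y + (SUP k. first_jump (\<lambda>t x. feller_iter q k t x y) t x)"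
    unfolding feller_iter_Suc by (simp add: ennreal_SUP_add_right)
  also have "(SUP k. first_jump (\<lambda>t x. feller_iter q k t x y) t x)
      = first_jump (\<lambda>t x. transition q t x y) t x"
    unfolding transition_def
    by (rule first_jump_SUP[symmetric, OF feller_iter_measurable incseq_feller_iter])
  finally show ?thesis .
qed

section \<open>Expectations under the minimal transition function\<close>

definition expect_iter :: "nat \<Rightarrow> ('s \<Rightarrow> ennreal) \<Rightarrow> real \<Rightarrow> 's \<Rightarrow> ennreal" where
  "expect_iter k f t x = (\<integral>\<^sup>+ y. feller_iter q k t x y * f y \<partial>count_space UNIV)"

definition expect :: "('s \<Rightarrow> ennreal) \<Rightarrow> real \<Rightarrow> 's \<Rightarrow> ennreal" where
  "expect f t x = (\<integral>\<^sup>+ y. transition q t x y * f y \<partial>count_space UNIV)"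

lemma expect_iter_0: "expect_iter 0 f t x = ennreal (exp (q x x * t)) * f x"
proof -
  have "expect_iter 0 f t x
      = (\<integral>\<^sup>+ y. ennreal (exp (q x x * t)) * f x * indicator {x} y \<partial>count_space UNIV)"
    unfolding expect_iter_def by (intro nn_integral_cong) (auto simp: indicator_def)
  then show ?thesis by (simp add: nn_integral_cmult_indicator)
qed

lemma time_measurable_multc:
  assumes "time_measurable f" shows "time_measurable (\<lambda>t x. f t x * c)"
proof -
  have [measurable]: "(\<lambda>t. f t x) \<in> borel_measurable borel" for x
    using assms by (simp add: time_measurable_def)
  show ?thesis unfolding time_measurable_def by simp
qed

lemma first_jump_multc:
  assumes "time_measurable f"
  shows "first_jump (\<lambda>t x. f t x * c) t x = first_jump f t x * c"
proof -
  have "jump (\<lambda>w. f s w * c) x = jump (f s) x * c" for s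
    unfolding jump_def by (simp add: mult.assoc[symmetric] nn_integral_multc)
  moreover note [measurable] = jump_shift_measurable[OF assms]
  ultimately show ?thesis unfolding first_jump_def
    by (subst nn_integral_multc[symmetric]) (auto intro!: nn_integral_cong simp: mult_ac)
qed

lemma expect_iter_Suc:
  "expect_iter (Suc k) f t x = ennreal (exp (q x x * t)) * f x + first_jump (expect_iter k f) t x"
proof -
  have "expect_iter (Suc k) f t x = (\<integral>\<^sup>+ y. feller_iter q 0 t x y * f y \<partial>count_space UNIV)
      + (\<integral>\<^sup>+ y. first_jump (\<lambda>t x. feller_iter q k t x y) t x * f y \<partial>count_space UNIV)"
    by (simp only: expect_iter_def feller_iter_Suc distrib_right)
       (rule nn_integral_add; simp)
  also have "(\<integral>\<^sup>+ y. first_jump (\<lambda>t x. feller_iter q k t x y) t x * f y \<partial>count_space UNIV)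
      = (\<integral>\<^sup>+ y. first_jump (\<lambda>t x. feller_iter q k t x y * f y) t x \<partial>count_space UNIV)"
    by (intro nn_integral_cong first_jump_multc[symmetric] feller_iter_measurable)
  also have "\<dots> = first_jump (expect_iter k f) t x"
    unfolding expect_iter_def
    by (rule first_jump_nn_integral[symmetric])
       (intro time_measurable_multc feller_iter_measurable)
  finally show ?thesis using expect_iter_0[of f t x] by (simp only: expect_iter_def)
qed

lemma expect_eq_SUP: "expect f t x = (SUP k. expect_iter k f t x)"
  unfolding expect_def expect_iter_def transition_def SUP_mult_right_ennreal
  using incseq_feller_iter by (intro nn_integral_monotone_convergence_SUP)
    (auto simp: incseq_def le_fun_def intro!: mult_right_mono)

lemma expect_iter_measurable: "time_measurable (expect_iter k f)"
proof (induction k)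
  case 0
  show ?case by (simp add: time_measurable_def expect_iter_0)
next
  case (Suc k)
  have [measurable]: "(\<lambda>t. first_jump (expect_iter k f) t x) \<in> borel_measurable borel" for x
    using first_jump_measurable[OF Suc] by (simp add: time_measurable_def)
  show ?case by (simp add: time_measurable_def expect_iter_Suc)
qed

text \<open>Minimality of the Feller solution: \<open>first_jump\<close> is monotone, so an upper
  solution dominates every iterate by induction on the number of jumps, hence also the
  supremum.\<close>

lemma expect_minimal:
  assumes "\<And>t x. 0 \<le> t \<Longrightarrow>
    ennreal (exp (q x x * t)) * f x + first_jump w t x \<le> w t x"
    and "0 \<le> t"
  shows "expect f t x \<le> w t x"
proof -
  have "expect_iter k f t x \<le> w t x" if "0 \<le> t" for k t x
    using that
  proof (induction k arbitrary: t x)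
    case 0
    have "expect_iter 0 f t x \<le> ennreal (exp (q x x * t)) * f x + first_jump w t x"
      by (simp add: expect_iter_0)
    also have "\<dots> \<le> w t x" by (rule assms(1)[OF 0])
    finally show ?case .
  next
    case (Suc k)
    have "expect_iter (Suc k) f t x \<le> ennreal (exp (q x x * t)) * f x + first_jump w t x"
      unfolding expect_iter_Suc by (intro add_left_mono first_jump_mono Suc)
    also have "\<dots> \<le> w t x" by (rule assms(1)[OF Suc.prems])
    finally show ?case .
  qed
  then show ?thesis unfolding expect_eq_SUP using assms(2) by (intro SUP_least) auto
qed

text \<open>Integrating the differential inequality against the survival factor \<open>exp (q x x * s)\<close>.\<close>

lemma supersolution:
  fixes w w' :: "real \<Rightarrow> 's \<Rightarrow> real" and h :: "'s \<Rightarrow> ennreal"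
  assumes deriv: "\<And>t. 0 \<le> t \<Longrightarrow> ((\<lambda>t. w t x) has_real_derivative w' t x) (at t)"
    and meas: "(\<lambda>t. w t x) \<in> borel_measurable borel" "(\<lambda>t. w' t x) \<in> borel_measurable borel"
    and nonneg: "\<And>t x. 0 \<le> t \<Longrightarrow> 0 \<le> w t x" "\<And>t. 0 \<le> t \<Longrightarrow> 0 \<le> w' t x - q x x * w t x"
    and ineq: "\<And>t. 0 \<le> t \<Longrightarrow>
      jump (\<lambda>y. h y + ennreal (w t y)) x \<le> ennreal (w' t x - q x x * w t x)"
    and t: "0 \<le> t"
  shows "ennreal (exp (q x x * t)) * ennreal (w 0 x)
      + first_jump (\<lambda>t y. h y + ennreal (w t y)) t x \<le> ennreal (w t x)"
proof -
  note [measurable] = meas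
  \<comment> \<open>Since \<open>?f\<close> is the derivative of \<open>?F\<close> and dominates the
    integrand of \<open>first_jump\<close>, the integral is at most the increment of
    \<open>?F\<close>, which is \<open>w t x\<close> less exactly the survival term.\<close>
  let ?F = "\<lambda>s. - (exp (q x x * s) * w (t - s) x)"
    and ?f = "\<lambda>s. exp (q x x * s) * (w' (t - s) x - q x x * w (t - s) x)"
  have F: "(?F has_real_derivative ?f s) (at s)" if "s \<in> {0..t}" for s
  proof -
    have "((\<lambda>s. w (t - s) x) has_real_derivative w' (t - s) x * (- 1)) (at s)"
      by (rule DERIV_chain2[OF deriv]) (use that in \<open>auto intro!: derivative_eq_intros\<close>)
    then show ?thesis
      by (auto intro!: derivative_eq_intros simp: algebra_simps)
  qed
  have f: "0 \<le> ?f s" if "s \<in> {0..t}" for s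
    using that by (intro mult_nonneg_nonneg nonneg) auto
  have "first_jump (\<lambda>t y. h y + ennreal (w t y)) t x
      \<le> (\<integral>\<^sup>+ s. ennreal (?f s) * indicator {0..t} s \<partial>lborel)"
    unfolding first_jump_def
    by (intro nn_integral_mono) (auto simp: indicator_def ennreal_mult' intro!: mult_left_mono ineq)
  also have "\<dots> = ennreal (?F t - ?F 0)"
    by (rule nn_integral_FTC_Icc[OF _ F f t]) auto
  finally have le: "first_jump (\<lambda>t y. h y + ennreal (w t y)) t x
      \<le> ennreal (w t x - exp (q x x * t) * w 0 x)"
    by simp
  have "?F 0 \<le> ?F t"
  proof (rule DERIV_nonneg_imp_nondecreasing[OF t])
    show "\<exists>d. (?F has_real_derivative d) (at s) \<and> 0 \<le> d" if "0 \<le> s" "s \<le> t" for s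
      by (intro exI[of _ "?f s"] conjI F f) (use that in auto)
  qed
  then have "ennreal (exp (q x x * t)) * ennreal (w 0 x)
      + ennreal (w t x - exp (q x x * t) * w 0 x) = ennreal (w t x)"
    using nonneg(1)[of 0 x]
    by (simp add: ennreal_mult'[symmetric] ennreal_plus[symmetric] del: ennreal_plus)
  then show ?thesis using add_left_mono[OF le] by metis
qed

section \<open>Non-explosion\<close>

primrec excess_jumps :: "nat \<Rightarrow> real \<Rightarrow> 's \<Rightarrow> ennreal" where
  "excess_jumps 0 = (\<lambda>t x. 1)"
| "excess_jumps (Suc k) = first_jump (excess_jumps k)"

lemma excess_jumps_measurable: "time_measurable (excess_jumps k)"
  by (induction k) (auto simp: time_measurable_def[of "\<lambda>t x. 1"] intro!: first_jump_measurable)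

text \<open>The iterate \<open>k\<close> keeps the paths with at most \<open>k\<close> jumps, and
  \<open>excess_jumps (Suc k)\<close> is the probability of at least \<open>k + 1\<close> jumps, so
  together they exhaust the mass.\<close>

lemma expect_iter_one_plus_excess:
  assumes "0 \<le> t"
  shows "expect_iter k (\<lambda>_. 1) t x + excess_jumps (Suc k) t x = 1"
  using assms
proof (induction k arbitrary: t x)
  case 0
  then show ?case by (simp add: expect_iter_0 first_jump_one)
next
  case (Suc k)
  have "first_jump (expect_iter k (\<lambda>_. 1)) t x + first_jump (excess_jumps (Suc k)) t x
      = first_jump (\<lambda>t x. expect_iter k (\<lambda>_. 1) t x + excess_jumps (Suc k) t x) t x"
    by (rule first_jump_add[symmetric, OF expect_iter_measurable excess_jumps_measurable])
  also have "\<dots> = first_jump (\<lambda>t x. 1) t x"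
    by (intro antisym first_jump_mono) (simp_all only: Suc order_refl)
  finally show ?case
    using first_jump_one[OF Suc.prems, of x] by (simp add: expect_iter_Suc add.assoc)
qed

text \<open>The hypothesis says that \<open>v\<close> dominates the expected number of jumps, so the probability of more
  than \<open>k\<close> jumps tends to 0.\<close>

lemma expect_one:
  fixes v :: "real \<Rightarrow> 's \<Rightarrow> real"
  assumes super: "\<And>t x. 0 \<le> t \<Longrightarrow> first_jump (\<lambda>t y. 1 + ennreal (v t y)) t x \<le> ennreal (v t x)"
    and t: "0 \<le> t"
  shows "expect (\<lambda>_. 1) t x = 1"
proof -
  have meas_sum: "time_measurable (\<lambda>t x. \<Sum>k<N. excess_jumps (Suc k) t x)" for N
    using excess_jumps_measurable unfolding time_measurable_def
    by (auto intro!: borel_measurable_sum simp del: excess_jumps.simps)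
  \<comment> \<open>Partial sums of the tail probabilities are truncated expected jump counts.
    Conditioning on the first jump gives this recursion; the summand 1 is the first jump
    itself.\<close>
  have sum_Suc: "(\<Sum>k<Suc N. excess_jumps (Suc k) t x)
      = first_jump (\<lambda>t x. 1 + (\<Sum>k<N. excess_jumps (Suc k) t x)) t x" for N t x
  proof (induction N)
    case 0
    show ?case by simp
  next
    case (Suc N)
    have "first_jump (\<lambda>t x. 1 + (\<Sum>k<Suc N. excess_jumps (Suc k) t x)) t x
        = first_jump (\<lambda>t x. (1 + (\<Sum>k<N. excess_jumps (Suc k) t x)) + excess_jumps (Suc N) t x) t x"
      by (simp add: add.assoc del: excess_jumps.simps)
    also have "\<dots> = first_jump (\<lambda>t x. 1 + (\<Sum>k<N. excess_jumps (Suc k) t x)) t x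
        + first_jump (excess_jumps (Suc N)) t x"
      using meas_sum[of N]
      by (intro first_jump_add excess_jumps_measurable)
         (auto intro!: borel_measurable_add simp: time_measurable_def simp del: excess_jumps.simps)
    also have "\<dots> = (\<Sum>k<Suc N. excess_jumps (Suc k) t x) + excess_jumps (Suc (Suc N)) t x"
      by (simp only: Suc.IH excess_jumps.simps(2)[of "Suc N"])
    finally show ?case by (simp only: sum.lessThan_Suc)
  qed
  have bound: "(\<Sum>k<N. excess_jumps (Suc k) t x) \<le> ennreal (v t x)" if "0 \<le> t" for N t x
    using that
  proof (induction N arbitrary: t x)
    case 0
    show ?case by simp
  next
    case (Suc N)
    have "(\<Sum>k<Suc N. excess_jumps (Suc k) t x) \<le> first_jump (\<lambda>t y. 1 + ennreal (v t y)) t x"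
      unfolding sum_Suc by (intro first_jump_mono add_left_mono Suc.IH)
    also have "\<dots> \<le> ennreal (v t x)" by (rule super[OF Suc.prems])
    finally show ?case .
  qed
  \<comment> \<open>A finite expected count makes the tail probabilities the terms of a convergent
    series, so they vanish in the limit.\<close>
  have "(\<Sum>k. excess_jumps (Suc k) t x) \<le> ennreal (v t x)"
    by (rule suminf_le_const[OF summableI bound[OF t]])
  then have "(\<Sum>k. excess_jumps (Suc k) t x) \<noteq> \<top>"
    by (metis ennreal_less_top leD top.not_eq_extremum)
  then have lim: "(\<lambda>k. excess_jumps (Suc k) t x) \<longlonglongrightarrow> 0"
  proof -
    assume top: "(\<Sum>k. excess_jumps (Suc k) t x) \<noteq> \<top>"
    have "excess_jumps (Suc k) t x \<le> 1" for k
      by (subst expect_iter_one_plus_excess[OF t, of k x, symmetric]) simp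
    then have eq: "excess_jumps (Suc k) t x = ennreal (enn2real (excess_jumps (Suc k) t x))" for k
      by (metis ennreal_enn2real ennreal_one_less_top order_le_less_trans)
    have "(\<Sum>k. ennreal (enn2real (excess_jumps (Suc k) t x))) \<noteq> \<top>"
      using top by (simp only: eq[symmetric] not_False_eq_True)
    then have "summable (\<lambda>k. enn2real (excess_jumps (Suc k) t x))"
      by (intro summable_suminf_not_top) auto
    then have "(\<lambda>k. ennreal (enn2real (excess_jumps (Suc k) t x))) \<longlonglongrightarrow> ennreal 0"
      by (intro tendsto_ennrealI summable_LIMSEQ_zero)
    then show ?thesis by (simp only: eq[symmetric] ennreal_0)
  qed
  have "1 \<le> expect (\<lambda>_. 1) t x + excess_jumps (Suc k) t x" for k
    unfolding expect_eq_SUP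
    by (subst expect_iter_one_plus_excess[OF t, of k x, symmetric])
       (intro add_right_mono SUP_upper, simp)
  then have "1 \<le> expect (\<lambda>_. 1) t x + 0"
    by (intro LIMSEQ_le_const[OF tendsto_add[OF tendsto_const lim]]) auto
  moreover have "expect_iter k (\<lambda>_. 1) t x \<le> 1" for k
    by (subst expect_iter_one_plus_excess[OF t, of k x, symmetric]) simp
  then have "expect (\<lambda>_. 1) t x \<le> 1"
    unfolding expect_eq_SUP by (intro SUP_least)
  ultimately show ?thesis by (intro antisym) simp_all
qed

section \<open>Semigroup inequality and positivity of transitions\<close>

lemma transition_add_ge:
  assumes s: "0 \<le> s" and t: "0 \<le> t"
  shows "expect (\<lambda>w. transition q t w y) s x \<le> transition q (s + t) x y"
\<comment> \<open>The function \<open>transition q (s + t) x y\<close> of \<open>s\<close> starts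
  from \<open>transition q t x y\<close> and solves the backward equation in \<open>s\<close>: the
  first-jump integral over \<open>{0..s + t}\<close> is split at \<open>s\<close>. Minimality then
  bounds the composed transition by it.\<close>
proof (rule expect_minimal[OF _ s])
  fix s x assume s: "(0::real) \<le> s"
  let ?e = "\<lambda>r. ennreal (exp (q x x * r))"
    and ?j = "\<lambda>r. jump (\<lambda>w. transition q r w y) x"
  note [measurable] = jump_shift_measurable[OF transition_measurable]
  have e_add: "?e (s + r) = ?e s * ?e r" for r
    by (simp add: ennreal_mult[symmetric] exp_add[symmetric] distrib_left)
  have "(\<integral>\<^sup>+ r\<in>{s..s + t}. ?e r * ?j (s + t - r) \<partial>lborel)
      = (\<integral>\<^sup>+ r. ?e (s + r) * ?j (t - r) * indicator {0..t} r \<partial>lborel)"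
    by (subst nn_integral_real_affine[where c = 1 and t = s])
       (auto simp: indicator_def intro!: nn_integral_cong)
  also have "\<dots> = ?e s * first_jump (\<lambda>t x. transition q t x y) t x"
    unfolding first_jump_def e_add
    by (subst nn_integral_cmult[symmetric]) (auto simp: mult_ac)
  finally have tail: "?e s * first_jump (\<lambda>t x. transition q t x y) t x
      = (\<integral>\<^sup>+ r\<in>{s..s + t}. ?e r * ?j (s + t - r) \<partial>lborel)" ..
  have head: "first_jump (\<lambda>s x. transition q (s + t) x y) s x
      = (\<integral>\<^sup>+ r\<in>{0..s}. ?e r * ?j (s + t - r) \<partial>lborel)"
    unfolding first_jump_def by (simp add: algebra_simps)
  have "?e s * first_jump (\<lambda>t x. transition q t x y) t x
      + first_jump (\<lambda>s x. transition q (s + t) x y) s x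
      = (\<integral>\<^sup>+ r. ?e r * ?j (s + t - r) * indicator {s..s + t} r
          + ?e r * ?j (s + t - r) * indicator {0..s} r \<partial>lborel)"
    unfolding tail head by (rule nn_integral_add[symmetric]) measurable
  also have "\<dots> \<le> (\<integral>\<^sup>+ r\<in>{0..s + t}. ?e r * ?j (s + t - r) \<partial>lborel)"
  \<comment> \<open>The two intervals share only the point \<open>s\<close>, a null set.\<close>
  proof (rule nn_integral_mono_AE)
    show "AE r in lborel. ?e r * ?j (s + t - r) * indicator {s..s + t} r
        + ?e r * ?j (s + t - r) * indicator {0..s} r \<le> ?e r * ?j (s + t - r) * indicator {0..s + t} r"
      using AE_lborel_singleton[of s] by eventually_elim (use s t in \<open>auto simp: indicator_def\<close>)
  qed
  also have "\<dots> = first_jump (\<lambda>t x. transition q t x y) (s + t) x"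
    by (simp add: first_jump_def)
  finally have int: "?e s * first_jump (\<lambda>t x. transition q t x y) t x
      + first_jump (\<lambda>s x. transition q (s + t) x y) s x
      \<le> first_jump (\<lambda>t x. transition q t x y) (s + t) x" .
  have "?e s * transition q t x y + first_jump (\<lambda>s x. transition q (s + t) x y) s x
      = ?e s * feller_iter q 0 t x y + (?e s * first_jump (\<lambda>t x. transition q t x y) t x
      + first_jump (\<lambda>s x. transition q (s + t) x y) s x)"
    by (subst transition_backward) (simp only: distrib_left add.assoc)
  also have "\<dots> \<le> ?e s * feller_iter q 0 t x y
      + first_jump (\<lambda>t x. transition q t x y) (s + t) x"
    by (intro add_left_mono int)
  also have "\<dots> = transition q (s + t) x y"
    using e_add[of t] by (subst transition_backward[of "s + t"]) auto
  finally show "?e s * transition q t x y + first_jump (\<lambda>s x. transition q (s + t) x y) s x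
      \<le> transition q (s + t) x y" .
qed

lemma transition_refl_pos: "0 < transition q t x x"
  by (subst transition_backward) (simp add: add_pos_nonneg)

text \<open>The backward equation contains the paths jumping first to \<open>w\<close>. Their
  integrand is strictly positive on the open interval between 0 and \<open>t\<close>, which has
  positive length.\<close>

lemma transition_step_pos:
  assumes rate: "0 < q x w" "x \<noteq> w" and pos: "\<And>s. 0 < s \<Longrightarrow> 0 < transition q s w y" and t: "0 < t"
  shows "0 < transition q t x y"
proof -
  let ?g = "\<lambda>s. ennreal (exp (q x x * s)) * jump (\<lambda>w. transition q (t - s) w y) x * indicator {0..t} s"
  note [measurable] = jump_shift_measurable[OF transition_measurable]
  have jpos: "jump (\<lambda>w. transition q r w y) x \<noteq> 0" if "0 < r" for r
  proof -
    have "0 < ennreal (q x w) * transition q r w y"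
      using rate pos[OF that] by (simp add: ennreal_zero_less_mult_iff)
    then show ?thesis
      unfolding jump_def using rate(2)
      by (auto simp: nn_integral_0_iff_AE AE_count_space intro!: bexI[of _ w])
  qed
  have "first_jump (\<lambda>t x. transition q t x y) t x \<noteq> 0"
  proof
    assume "first_jump (\<lambda>t x. transition q t x y) t x = 0"
    then have "AE s in lborel. ?g s = 0"
      unfolding first_jump_def by (subst (asm) nn_integral_0_iff_AE) auto
    then have "AE s in lborel. s \<notin> {0<..<t}"
      by eventually_elim (auto simp: indicator_def jpos)
    then have "{0<..<t} \<in> null_sets lborel"
      by (intro AE_iff_null_sets[THEN iffD2]) simp_all
    then show False using t by (simp add: null_sets_def)
  qed
  then show ?thesis
    by (subst transition_backward) (simp add: add_nonneg_pos zero_less_iff_neq_zero)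
qed

end

text \<open>Both masses are 1, so a strict gain at one point could not be compensated elsewhere.
  This turns the one-sided estimates below into equalities.\<close>

lemma pmf_le_imp_eq:
  assumes "\<And>y. pmf p y \<le> pmf r y"
  shows "p = r"
proof (rule pmf_eqI, rule ccontr)
  fix y assume "pmf p y \<noteq> pmf r y"
  with assms[of y] have less: "pmf p y < pmf r y" by simp
  have le: "emeasure (measure_pmf p) A \<le> emeasure (measure_pmf r) A" for A
    unfolding nn_integral_pmf[symmetric] by (intro nn_integral_mono) (simp add: assms)
  then have "measure_pmf.prob p (- {y}) \<le> measure_pmf.prob r (- {y})"
    by (simp add: measure_pmf.emeasure_eq_measure)
  moreover have "measure_pmf.prob p (- {y}) = 1 - pmf p y" for p
    using measure_pmf.prob_compl[of "{y}" p] by (simp add: pmf.rep_eq Compl_eq_Diff_UNIV)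
  ultimately show False using less by simp
qed

locale honest_rates = conservative_rates +
  assumes honest: "\<And>t x. 0 \<le> t \<Longrightarrow> expect (\<lambda>_. 1) t x = 1"
begin

text \<open>For \<open>0 \<le> t\<close> honesty gives total mass 1, so that
  \<open>embed_pmf\<close> really represents the transition probabilities; the facts about
  \<open>kernel\<close> are therefore stated for nonnegative times.\<close>

definition kernel :: "real \<Rightarrow> 'a \<Rightarrow> 'a pmf" where
  "kernel t x = embed_pmf (\<lambda>y. enn2real (transition q t x y))"

lemma ennreal_pmf_kernel:
  assumes "0 \<le> t"
  shows "ennreal (pmf (kernel t x) y) = transition q t x y"
proof -
  have one: "(\<integral>\<^sup>+ y. transition q t x y \<partial>count_space UNIV) = 1"
    using honest[OF assms, of x] by (simp add: expect_def)
  have fin: "transition q t x y \<noteq> \<top>" for y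
  proof -
    have "transition q t x y \<le> (\<integral>\<^sup>+ y. transition q t x y \<partial>count_space UNIV)"
      by (rule nn_integral_ge_point) simp
    then show ?thesis unfolding one by (auto simp: top_unique)
  qed
  have "pmf (kernel t x) y = enn2real (transition q t x y)"
    unfolding kernel_def
    by (rule pmf_embed_pmf) (simp_all add: ennreal_enn2real_if fin one)
  then show ?thesis by (simp add: ennreal_enn2real_if fin)
qed

lemma nn_integral_kernel:
  "0 \<le> t \<Longrightarrow> (\<integral>\<^sup>+ y. f y \<partial>measure_pmf (kernel t x)) = expect f t x"
  by (simp add: nn_integral_measure_pmf expect_def ennreal_pmf_kernel)

text \<open>Minimality gives one inequality, and both sides have total mass 1.\<close>

lemma kernel_add:
  assumes "0 \<le> s" "0 \<le> t"
  shows "bind_pmf (kernel s x) (kernel t) = kernel (s + t) x"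
proof (rule pmf_le_imp_eq)
  fix y
  have "ennreal (pmf (bind_pmf (kernel s x) (kernel t)) y) \<le> ennreal (pmf (kernel (s + t) x) y)"
    unfolding ennreal_pmf_bind using transition_add_ge[OF assms, of y x] assms
    by (simp add: nn_integral_kernel ennreal_pmf_kernel)
  then show "pmf (bind_pmf (kernel s x) (kernel t)) y \<le> pmf (kernel (s + t) x) y"
    by simp
qed

lemma stationary_iff_kernel: "stationary q \<pi> \<longleftrightarrow> (\<forall>t\<ge>0. bind_pmf \<pi> (kernel t) = \<pi>)"
proof -
  have "(\<forall>y. (\<integral>\<^sup>+ x. transition q t x y \<partial>measure_pmf \<pi>) = ennreal (pmf \<pi> y))
      \<longleftrightarrow> bind_pmf \<pi> (kernel t) = \<pi>" if "0 \<le> t" for t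
  proof -
    have "(\<integral>\<^sup>+ x. transition q t x y \<partial>measure_pmf \<pi>) = ennreal (pmf (bind_pmf \<pi> (kernel t)) y)" for y
      using that by (simp add: ennreal_pmf_bind ennreal_pmf_kernel)
    then show ?thesis by (auto simp: pmf_eq_iff)
  qed
  then show ?thesis unfolding stationary_def by auto
qed

end

section \<open>Invariant distributions of countable Markov kernels\<close>

text \<open>The enumeration \<open>to_nat\<close> exhausts the type by finite sets, and monotone
  convergence passes the bound to the limit.\<close>

lemma nn_integral_count_space_le:
  fixes f :: "'s::countable \<Rightarrow> ennreal"
  assumes "\<And>F. finite F \<Longrightarrow> sum f F \<le> c"
  shows "(\<integral>\<^sup>+ x. f x \<partial>count_space UNIV) \<le> c"
proof -
  let ?A = "\<lambda>n. {x::'s. to_nat x \<le> n}"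
  have fin: "finite (?A n)" for n
    by (rule finite_imageD[of to_nat]) (auto intro: finite_subset[of _ "{..n}"])
  have "f x = (SUP n. f x * indicator (?A n) x)" for x
    by (intro antisym SUP_least)
       (auto simp: indicator_def intro!: SUP_upper2[of "to_nat x"])
  then have "(\<integral>\<^sup>+ x. f x \<partial>count_space UNIV)
      = (\<integral>\<^sup>+ x. (SUP n. f x * indicator (?A n) x) \<partial>count_space UNIV)"
    by simp
  also have "\<dots> = (SUP n. \<integral>\<^sup>+ x. f x * indicator (?A n) x \<partial>count_space UNIV)"
    by (intro nn_integral_monotone_convergence_SUP)
       (auto simp: incseq_def le_fun_def indicator_def)
  also have "\<dots> = (SUP n. sum f (?A n))"
    by (simp add: nn_integral_count_space_indicator[symmetric] nn_integral_count_space_finite fin)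
  also have "\<dots> \<le> c"
    by (intro SUP_least assms fin)
  finally show ?thesis .
qed

text \<open>The minimum of two invariant laws is subinvariant with preserved mass, hence invariant; where
  it agrees with one of them at a point reached from everywhere, it agrees with it everywhere.\<close>

lemma invariant_pmf_unique:
  fixes K :: "'s::countable \<Rightarrow> 's pmf"
  assumes pos: "\<And>x. 0 < pmf (K x) o'"
    and \<mu>: "bind_pmf \<mu> K = \<mu>" and \<nu>: "bind_pmf \<nu> K = \<nu>"
  shows "\<mu> = \<nu>"
proof -
  have le: "pmf \<mu> x \<le> pmf \<nu> x"
    if \<mu>: "bind_pmf \<mu> K = \<mu>" and \<nu>: "bind_pmf \<nu> K = \<nu>" and o': "pmf \<mu> o' \<le> pmf \<nu> o'"
    for \<mu> \<nu> x
  proof (rule ccontr)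
    assume "\<not> pmf \<mu> x \<le> pmf \<nu> x"
    define m where "m x = min (pmf \<mu> x) (pmf \<nu> x)" for x
    let ?C = "count_space UNIV :: 's measure"
    have m_nonneg: "0 \<le> m x" for x by (simp add: m_def)
    have inv: "(\<integral>\<^sup>+ x. ennreal (pmf \<rho> x) * ennreal (pmf (K x) y) \<partial>?C) = ennreal (pmf \<rho> y)"
      if "bind_pmf \<rho> K = \<rho>" for \<rho> y
      using ennreal_pmf_bind[of \<rho> K y] that by (simp add: nn_integral_measure_pmf)
    let ?M = "\<lambda>y. \<integral>\<^sup>+ x. ennreal (m x) * ennreal (pmf (K x) y) \<partial>?C"
    have M_le: "?M y \<le> ennreal (m y)" for y
    proof -
      have "?M y \<le> (\<integral>\<^sup>+ x. ennreal (pmf \<mu> x) * ennreal (pmf (K x) y) \<partial>?C)"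
        "?M y \<le> (\<integral>\<^sup>+ x. ennreal (pmf \<nu> x) * ennreal (pmf (K x) y) \<partial>?C)"
        by (intro nn_integral_mono mult_right_mono; simp add: m_def)+
      then have "?M y \<le> ennreal (pmf \<mu> y)" "?M y \<le> ennreal (pmf \<nu> y)"
        by (simp_all only: inv[OF \<mu>] inv[OF \<nu>])
      then show ?thesis by (auto simp: m_def min_def)
    qed
    \<comment> \<open>At the point \<open>x\<close> where \<open>\<mu>\<close> exceeds
      \<open>\<nu>\<close> the minimum is strictly below \<open>\<mu>\<close>, and \<open>x\<close>
      reaches \<open>o'\<close> with positive probability, so mass is lost at \<open>o'\<close>.
      There the minimum equals \<open>\<mu>\<close>, so the loss makes subinvariance strict.\<close>
    have "?M o' < (\<integral>\<^sup>+ x. ennreal (pmf \<mu> x) * ennreal (pmf (K x) o') \<partial>?C)"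
    proof (rule nn_integral_less)
      show "?M o' \<noteq> \<infinity>"
        using M_le[of o'] by (auto simp: top_unique)
      show "AE x in ?C. ennreal (m x) * ennreal (pmf (K x) o') \<le> ennreal (pmf \<mu> x) * ennreal (pmf (K x) o')"
        by (intro AE_I2 mult_right_mono) (auto simp: m_def)
      have "\<not> ennreal (pmf \<mu> x) * ennreal (pmf (K x) o') \<le> ennreal (m x) * ennreal (pmf (K x) o')"
        using \<open>\<not> pmf \<mu> x \<le> pmf \<nu> x\<close> pos[of x] m_nonneg[of x]
        by (simp add: ennreal_mult[symmetric] m_def)
      then show "\<not> (AE x in ?C. ennreal (pmf \<mu> x) * ennreal (pmf (K x) o')
          \<le> ennreal (m x) * ennreal (pmf (K x) o'))"
        by (auto simp: AE_count_space)
    qed auto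
    then have less: "?M o' < ennreal (m o')"
      unfolding inv[OF \<mu>] using o' by (simp add: m_def)
    \<comment> \<open>Rows of \<open>K\<close> have mass 1, so transporting \<open>m\<close>
      preserves its total; this contradicts \<open>?M \<le> m\<close> with strict inequality at
      \<open>o'\<close>.\<close>
    have "(\<integral>\<^sup>+ y. ?M y \<partial>?C) = (\<integral>\<^sup>+ x. ennreal (m x) * (\<integral>\<^sup>+ y. ennreal (pmf (K x) y) \<partial>?C) \<partial>?C)"
      by (subst nn_integral_count_space_nn_integral) (auto simp: nn_integral_cmult)
    then have mass: "(\<integral>\<^sup>+ y. ?M y \<partial>?C) = (\<integral>\<^sup>+ x. ennreal (m x) \<partial>?C)"
      by (simp add: nn_integral_pmf)
    have "(\<integral>\<^sup>+ x. ennreal (m x) \<partial>?C) \<le> (\<integral>\<^sup>+ x. ennreal (pmf \<mu> x) \<partial>?C)"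
      by (intro nn_integral_mono) (simp add: m_def)
    then have "(\<integral>\<^sup>+ x. ennreal (m x) \<partial>?C) \<noteq> \<infinity>"
      by (auto simp: nn_integral_pmf top_unique)
    then have "(\<integral>\<^sup>+ y. ?M y \<partial>?C) < (\<integral>\<^sup>+ x. ennreal (m x) \<partial>?C)"
      using M_le less by (intro nn_integral_less) (auto simp: mass AE_count_space not_le)
    then show False by (simp add: mass)
  qed
  show ?thesis
    using le[OF \<mu> \<nu>] le[OF \<nu> \<mu>] pmf_le_imp_eq[of \<mu> \<nu>] pmf_le_imp_eq[of \<nu> \<mu>]
    by (cases "pmf \<mu> o' \<le> pmf \<nu> o'") auto
qed

text \<open>A product of compact intervals is compact by Tychonoff; over a countable index type it
  is metrizable, so compactness gives convergent subsequences.\<close>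

lemma pointwise_convergent_subsequence:
  fixes p :: "nat \<Rightarrow> 's::countable \<Rightarrow> real"
  assumes "\<And>n x. p n x \<in> {0..1}"
  obtains r l where "strict_mono (r :: nat \<Rightarrow> nat)" "\<And>x. (\<lambda>j. p (r j) x) \<longlonglongrightarrow> l x"
proof -
  let ?S = "PiE UNIV (\<lambda>_. {0..1}) :: ('s \<Rightarrow> real) set"
  have "compactin (product_topology (\<lambda>_. euclidean) UNIV) ?S"
    by (simp add: compactin_PiE)
  then have "compact ?S"
    by (simp add: euclidean_product_topology)
  then have "seq_compact ?S" by (rule compact_imp_seq_compact)
  moreover have "\<forall>n. p n \<in> ?S" using assms by auto
  ultimately obtain l r where r: "strict_mono r" "(p \<circ> r) \<longlonglongrightarrow> l"
    unfolding seq_compact_def by blast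
  have "(\<lambda>j. p (r j) x) \<longlonglongrightarrow> l x" for x
  proof -
    have "isCont (\<lambda>f::'s \<Rightarrow> real. f x) l"
      using continuous_on_product_coordinates[of x]
      by (metis UNIV_I continuous_on_eq_continuous_at open_UNIV)
    from isCont_tendsto_compose[OF this r(2)] show ?thesis by (simp add: o_def)
  qed
  with r(1) show ?thesis using that by blast
qed

text \<open>Krylov-Bogolyubov argument. Markov's inequality for \<open>V\<close> keeps mass from
  escaping along the averages. The pointwise limit commutes with finite sums, which yields
  subinvariance, and equality of masses gives invariance.\<close>

lemma invariant_pmf_exists:
  fixes K :: "'s::countable \<Rightarrow> 's pmf" and \<mu> :: "nat \<Rightarrow> 's pmf" and V :: "'s \<Rightarrow> real"
  assumes step: "\<And>k. \<mu> (Suc k) = bind_pmf (\<mu> k) K"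
    and V: "\<And>R. finite {x. V x \<le> R}"
    and bound: "\<And>k. (\<integral>\<^sup>+ x. ennreal (V x) \<partial>measure_pmf (\<mu> k)) \<le> ennreal C"
    and C: "0 \<le> C"
  shows "\<exists>\<pi>. bind_pmf \<pi> K = \<pi>"
proof -
  define p where "p N y = (\<Sum>k<Suc N. pmf (\<mu> k) y) / real (Suc N)" for N y
  have p_nonneg: "0 \<le> p N y" for N y
    unfolding p_def by (intro divide_nonneg_nonneg sum_nonneg) auto
  have sum_p: "sum (p N) F = (\<Sum>k<Suc N. measure_pmf.prob (\<mu> k) F) / real (Suc N)" if "finite F" for N F
    unfolding p_def sum_divide_distrib[symmetric]
    by (subst sum.swap) (simp add: measure_measure_pmf_finite that)
  have sum_p_le: "sum (p N) F \<le> 1" if "finite F" for N F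
  proof -
    have "(\<Sum>k<Suc N. measure_pmf.prob (\<mu> k) F) \<le> (\<Sum>k<Suc N. 1)"
      by (intro sum_mono) simp
    then show ?thesis by (simp add: sum_p[OF that] del: sum.lessThan_Suc)
  qed
  have "p N y \<in> {0..1}" for N y
    using sum_p_le[of "{y}" N] p_nonneg[of N y] by simp
  then obtain r l where r: "strict_mono (r :: nat \<Rightarrow> nat)" and lim: "\<And>x. (\<lambda>j. p (r j) x) \<longlonglongrightarrow> l x"
    by (rule pointwise_convergent_subsequence[of p]) auto
  have l_nonneg: "0 \<le> l x" for x
    by (rule LIMSEQ_le_const[OF lim]) (simp add: p_nonneg)
  have l_le: "sum l F \<le> 1" if "finite F" for F
    by (rule LIMSEQ_le_const2[OF tendsto_sum[OF lim]]) (use sum_p_le[OF that] in auto)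
  have prob_ge: "1 - C / R \<le> measure_pmf.prob (\<mu> k) {x. V x \<le> R}" if "0 < R" for R k
  proof -
    let ?B = "{x. V x \<le> R}"
    have "ennreal (R * measure_pmf.prob (\<mu> k) (- ?B)) = ennreal R * emeasure (\<mu> k) (- ?B)"
      using that by (simp add: ennreal_mult measure_pmf.emeasure_eq_measure)
    also have "\<dots> = (\<integral>\<^sup>+ x. ennreal R * indicator (- ?B) x \<partial>measure_pmf (\<mu> k))"
      by (simp add: nn_integral_cmult)
    also have "\<dots> \<le> (\<integral>\<^sup>+ x. ennreal (V x) \<partial>measure_pmf (\<mu> k))"
      by (intro nn_integral_mono) (auto simp: indicator_def intro!: ennreal_leI)
    also have "\<dots> \<le> ennreal C" by (rule bound)
    finally have "R * measure_pmf.prob (\<mu> k) (- ?B) \<le> C"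
      using C by simp
    moreover have "measure_pmf.prob (\<mu> k) (- ?B) = 1 - measure_pmf.prob (\<mu> k) ?B"
      using measure_pmf.prob_compl[of ?B "\<mu> k"] by (simp add: Compl_eq_Diff_UNIV)
    ultimately show ?thesis using that by (simp add: field_simps)
  qed
  \<comment> \<open>Sublevel sets of \<open>V\<close> are finite, so the uniform lower bound on
    their probability survives the pointwise limit and forces the limit to have mass 1.\<close>
  have l_ge: "1 - C / R \<le> sum l {x. V x \<le> R}" if "0 < R" for R
  proof (rule LIMSEQ_le_const[OF tendsto_sum[OF lim]], intro exI allI impI)
    fix j
    have "(\<Sum>k<Suc (r j). 1 - C / R) \<le> (\<Sum>k<Suc (r j). measure_pmf.prob (\<mu> k) {x. V x \<le> R})"
      by (intro sum_mono prob_ge that)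
    then show "1 - C / R \<le> (\<Sum>x\<in>{x. V x \<le> R}. p (r j) x)"
      unfolding sum_p[OF V] by (simp add: pos_le_divide_eq mult.commute del: sum.lessThan_Suc)
  qed
  have "(\<integral>\<^sup>+ x. ennreal (l x) \<partial>count_space UNIV) = 1"
  proof (rule antisym)
    show "(\<integral>\<^sup>+ x. ennreal (l x) \<partial>count_space UNIV) \<le> 1"
      using l_le l_nonneg by (intro nn_integral_count_space_le) (simp add: sum_ennreal)
    have "ennreal (1 - C / real (Suc k)) \<le> (\<integral>\<^sup>+ x. ennreal (l x) \<partial>count_space UNIV)" for k
    proof -
      let ?B = "{x. V x \<le> real (Suc k)}"
      have "ennreal (1 - C / real (Suc k)) \<le> ennreal (sum l ?B)"
        by (intro ennreal_leI l_ge) simp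
      also have "\<dots> = (\<integral>\<^sup>+ x. ennreal (l x) \<partial>count_space ?B)"
        using V l_nonneg by (simp add: nn_integral_count_space_finite sum_ennreal)
      also have "\<dots> \<le> (\<integral>\<^sup>+ x. ennreal (l x) \<partial>count_space UNIV)"
        by (subst nn_integral_count_space_indicator)
           (auto simp: indicator_def intro!: nn_integral_mono)
      finally show ?thesis .
    qed
    moreover have "(\<lambda>k. ennreal (1 - C / real (Suc k))) \<longlonglongrightarrow> ennreal (1 - 0)"
      by (intro tendsto_ennrealI tendsto_diff tendsto_const
            real_tendsto_divide_at_top[OF tendsto_const] filterlim_compose[OF filterlim_real_sequentially] filterlim_Suc)
    ultimately show "1 \<le> (\<integral>\<^sup>+ x. ennreal (l x) \<partial>count_space UNIV)"
      by (intro LIMSEQ_le_const2[of _ 1]) auto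
  qed
  then have pmf: "pmf (embed_pmf l) x = l x" for x
    using l_nonneg by (intro pmf_embed_pmf) auto
  have "bind_pmf (embed_pmf l) K = embed_pmf l"
  proof (rule pmf_le_imp_eq)
    fix y
    have fin_le: "(\<Sum>x\<in>F. l x * pmf (K x) y) \<le> l y" if F: "finite F" for F
    proof -
      have mu: "(\<Sum>x\<in>F. pmf (\<mu> k) x * pmf (K x) y) \<le> pmf (\<mu> (Suc k)) y" for k
      proof -
        have "ennreal (\<Sum>x\<in>F. pmf (\<mu> k) x * pmf (K x) y)
            = (\<integral>\<^sup>+ x. ennreal (pmf (\<mu> k) x * pmf (K x) y) \<partial>count_space F)"
          using F by (simp add: nn_integral_count_space_finite sum_ennreal)
        also have "\<dots> \<le> (\<integral>\<^sup>+ x. ennreal (pmf (\<mu> k) x) * ennreal (pmf (K x) y) \<partial>count_space UNIV)"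
          by (subst nn_integral_count_space_indicator)
             (auto simp: indicator_def ennreal_mult intro!: nn_integral_mono)
        also have "\<dots> = ennreal (pmf (\<mu> (Suc k)) y)"
          by (simp add: step ennreal_pmf_bind nn_integral_measure_pmf)
        finally show ?thesis by simp
      qed
      \<comment> \<open>One step of \<open>K\<close> shifts the summation index by one, and the two
        averages differ only in end terms of size at most \<open>1 / real (Suc N)\<close>.\<close>
      have pN: "(\<Sum>x\<in>F. p N x * pmf (K x) y) \<le> p N y + 1 / real (Suc N)" for N
      proof -
        have "real (Suc N) * (\<Sum>x\<in>F. p N x * pmf (K x) y)
            = (\<Sum>x\<in>F. (\<Sum>k<Suc N. pmf (\<mu> k) x) * pmf (K x) y)"
          by (simp add: p_def sum_distrib_left del: sum.lessThan_Suc)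
        also have "\<dots> = (\<Sum>k<Suc N. \<Sum>x\<in>F. pmf (\<mu> k) x * pmf (K x) y)"
          unfolding sum_distrib_right by (rule sum.swap)
        also have "\<dots> \<le> (\<Sum>k<Suc N. pmf (\<mu> (Suc k)) y)"
          by (intro sum_mono mu)
        also have "\<dots> \<le> (\<Sum>k<Suc (Suc N). pmf (\<mu> k) y)"
          by (subst (2) sum.lessThan_Suc_shift) simp
        also have "\<dots> \<le> (\<Sum>k<Suc N. pmf (\<mu> k) y) + 1"
          by (simp add: pmf_le_1)
        also have "\<dots> = real (Suc N) * (p N y + 1 / real (Suc N))"
          by (simp add: p_def distrib_left del: sum.lessThan_Suc of_nat_Suc)
        finally show ?thesis by (simp del: of_nat_Suc)
      qed
      have "(\<lambda>N. 1 / real (Suc N)) \<longlonglongrightarrow> 0"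
        using LIMSEQ_inverse_real_of_nat by (simp add: inverse_eq_divide)
      from LIMSEQ_subseq_LIMSEQ[OF this r]
      have inv: "(\<lambda>j. 1 / real (Suc (r j))) \<longlonglongrightarrow> 0" by (simp add: o_def)
      have "(\<Sum>x\<in>F. l x * pmf (K x) y) \<le> l y + 0"
        by (rule LIMSEQ_le[OF tendsto_sum[OF tendsto_mult[OF lim tendsto_const]]
              tendsto_add[OF lim inv]]) (use pN in auto)
      then show ?thesis by simp
    qed
    have "ennreal (pmf (bind_pmf (embed_pmf l) K) y)
        = (\<integral>\<^sup>+ x. ennreal (l x * pmf (K x) y) \<partial>count_space UNIV)"
      by (simp add: ennreal_pmf_bind nn_integral_measure_pmf pmf ennreal_mult l_nonneg)
    also have "\<dots> \<le> ennreal (l y)"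
      using fin_le l_nonneg by (intro nn_integral_count_space_le) (simp add: sum_ennreal)
    finally show "pmf (bind_pmf (embed_pmf l) K) y \<le> pmf (embed_pmf l) y"
      using l_nonneg by (simp add: pmf)
  qed
  then show ?thesis ..
qed

text \<open>Integrating the drift against \<open>\<pi>\<close> directly would presuppose that
  \<open>V\<close> is integrable. Truncation at \<open>M\<close> avoids this: dominated convergence
  removes \<open>a k * V x\<close> under the truncation, and only then does \<open>M\<close>
  grow.\<close>

lemma nn_integral_invariant_le:
  fixes K :: "nat \<Rightarrow> 's \<Rightarrow> 's pmf" and V :: "'s \<Rightarrow> real"
  assumes inv: "\<And>k. bind_pmf \<pi> (K k) = \<pi>"
    and V: "\<And>x. 0 \<le> V x" and C: "0 \<le> C" and a: "a \<longlonglongrightarrow> 0"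
    and drift: "\<And>k x. (\<integral>\<^sup>+ y. ennreal (V y) \<partial>measure_pmf (K k x)) \<le> ennreal (a k * V x + C)"
  shows "(\<integral>\<^sup>+ x. ennreal (V x) \<partial>measure_pmf \<pi>) \<le> ennreal C"
proof -
  have trunc: "(\<integral>\<^sup>+ x. ennreal (min (V x) (real M)) \<partial>measure_pmf \<pi>) \<le> ennreal C" for M
  proof -
    have le: "(\<integral>\<^sup>+ x. ennreal (min (V x) (real M)) \<partial>measure_pmf \<pi>)
        \<le> (\<integral>\<^sup>+ x. min (ennreal (a k * V x + C)) (ennreal (real M)) \<partial>measure_pmf \<pi>)" for k
    proof -
      have "(\<integral>\<^sup>+ x. ennreal (min (V x) (real M)) \<partial>measure_pmf \<pi>)
          = (\<integral>\<^sup>+ x. ennreal (min (V x) (real M)) \<partial>measure_pmf (bind_pmf \<pi> (K k)))"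
        by (simp add: inv)
      also have "\<dots> = (\<integral>\<^sup>+ x. \<integral>\<^sup>+ y. ennreal (min (V y) (real M)) \<partial>measure_pmf (K k x) \<partial>measure_pmf \<pi>)"
        by simp
      also have "\<dots> \<le> (\<integral>\<^sup>+ x. min (ennreal (a k * V x + C)) (ennreal (real M)) \<partial>measure_pmf \<pi>)"
      proof (intro nn_integral_mono min.boundedI)
        fix x
        have "(\<integral>\<^sup>+ y. ennreal (min (V y) (real M)) \<partial>measure_pmf (K k x))
            \<le> (\<integral>\<^sup>+ y. ennreal (V y) \<partial>measure_pmf (K k x))"
          by (intro nn_integral_mono ennreal_leI) simp
        with drift[of k x] show "(\<integral>\<^sup>+ y. ennreal (min (V y) (real M)) \<partial>measure_pmf (K k x))
            \<le> ennreal (a k * V x + C)" by (rule order_trans[rotated])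
        have "(\<integral>\<^sup>+ y. ennreal (min (V y) (real M)) \<partial>measure_pmf (K k x))
            \<le> (\<integral>\<^sup>+ y. ennreal (real M) \<partial>measure_pmf (K k x))"
          by (intro nn_integral_mono ennreal_leI) simp
        then show "(\<integral>\<^sup>+ y. ennreal (min (V y) (real M)) \<partial>measure_pmf (K k x)) \<le> ennreal (real M)"
          by simp
      qed
      finally show ?thesis .
    qed
    have "(\<lambda>k. \<integral>\<^sup>+ x. min (ennreal (a k * V x + C)) (ennreal (real M)) \<partial>measure_pmf \<pi>)
        \<longlonglongrightarrow> (\<integral>\<^sup>+ x. min (ennreal C) (ennreal (real M)) \<partial>measure_pmf \<pi>)"
    proof (rule nn_integral_dominated_convergence[where w = "\<lambda>_. ennreal (real M)"])
      have "(\<lambda>k. a k * V x + C) \<longlonglongrightarrow> 0 * V x + C" for x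
        by (intro tendsto_intros a)
      then show "AE x in measure_pmf \<pi>. (\<lambda>k. min (ennreal (a k * V x + C)) (ennreal (real M)))
          \<longlonglongrightarrow> min (ennreal C) (ennreal (real M))"
        by (intro AE_I2 tendsto_min tendsto_const tendsto_ennrealI) simp
    qed auto
    then have "(\<integral>\<^sup>+ x. ennreal (min (V x) (real M)) \<partial>measure_pmf \<pi>)
        \<le> (\<integral>\<^sup>+ x. min (ennreal C) (ennreal (real M)) \<partial>measure_pmf \<pi>)"
      by (rule LIMSEQ_le_const) (use le in blast)
    also have "\<dots> \<le> ennreal C" by (simp add: min_le_iff_disj)
    finally show ?thesis .
  qed
  have "ennreal (V x) = (SUP M. ennreal (min (V x) (real M)))" for x
  proof (rule antisym)
    obtain M where "V x \<le> real M" using real_arch_simple by blast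
    then show "ennreal (V x) \<le> (SUP M. ennreal (min (V x) (real M)))"
      by (intro SUP_upper2[of M]) (auto simp: min_def)
  qed (auto intro!: SUP_least ennreal_leI)
  then have "(\<integral>\<^sup>+ x. ennreal (V x) \<partial>measure_pmf \<pi>)
      = (\<integral>\<^sup>+ x. (SUP M. ennreal (min (V x) (real M))) \<partial>measure_pmf \<pi>)"
    by simp
  also have "\<dots> = (SUP M. \<integral>\<^sup>+ x. ennreal (min (V x) (real M)) \<partial>measure_pmf \<pi>)"
    by (intro nn_integral_monotone_convergence_SUP)
       (auto simp: incseq_def le_fun_def intro!: ennreal_leI)
  also have "\<dots> \<le> ennreal C" by (intro SUP_least trunc)
  finally show ?thesis .
qed

section \<open>The queueing process at a fixed level\<close>

text \<open>Keeps terms \<open>axis i 1\<close> over \<open>nat\<close> from being rewritten to \<open>axis i (Suc 0)\<close>.\<close>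

declare One_nat_def [simp del]

definition head_count :: "nat ^ 'm \<Rightarrow> nat" where
  "head_count x = (\<Sum>i\<in>UNIV. x $ i)"

lemma vec_minus_axis_plus_axis:
  fixes x :: "nat ^ 'm"
  shows "0 < x $ i \<Longrightarrow> x - axis i 1 + axis i 1 = x"
  by (auto simp: vec_eq_iff axis_def)

lemma vec_minus_axis_zero:
  fixes x :: "nat ^ 'm"
  shows "x $ i = 0 \<Longrightarrow> x - axis i 1 = x"
  by (auto simp: vec_eq_iff axis_def)

lemma head_count_plus_axis: "head_count (x + axis i 1) = Suc (head_count x)"
  by (simp add: head_count_def sum.distrib axis_def)

lemma head_count_minus_axis: "0 < x $ i \<Longrightarrow> head_count x = Suc (head_count (x - axis i 1))"
  using head_count_plus_axis[of "x - axis i 1" i] by (simp add: vec_minus_axis_plus_axis)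

lemma finite_head_count_le: "finite {x :: nat ^ 'm. head_count x \<le> k}"
proof -
  have "x $ i \<le> head_count x" for x :: "nat ^ 'm" and i
    unfolding head_count_def by (rule member_le_sum) auto
  then have "{x :: nat ^ 'm. head_count x \<le> k} \<subseteq> vec_lambda ` (PiE UNIV (\<lambda>_. {..k}))"
    by (auto intro!: image_eqI[where x = "\<lambda>i. _ $ i"] intro: order_trans)
  then show ?thesis by (rule finite_subset) (intro finite_imageI finite_PiE, auto)
qed

text \<open>The lower bound \<open>c\<close> on both service and patience rates makes every
  customer, served or waiting, leave at rate at least \<open>c\<close>; the upper bound
  \<open>D\<close> limits the growth of the jump rates.\<close>

locale queue_rates =
  fixes n :: nat and l u g :: "real ^ 'm" and z :: "nat ^ 'm \<Rightarrow> nat ^ 'm" and c D :: real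
  assumes l_nonneg: "\<And>i. 0 \<le> l $ i"
    and c_pos: "0 < c"
    and c_le: "\<And>i. c \<le> u $ i" "\<And>i. c \<le> g $ i"
    and le_D: "\<And>i. u $ i \<le> D" "\<And>i. g $ i \<le> D"
    and policy: "wc_policy n z"
begin

definition departure :: "nat ^ 'm \<Rightarrow> 'm \<Rightarrow> real" where
  "departure x i = u $ i * real (z x $ i) + g $ i * (real (x $ i) - real (z x $ i))"

abbreviation gen :: "(nat ^ 'm \<Rightarrow> real) \<Rightarrow> nat ^ 'm \<Rightarrow> real" where
  "gen f x \<equiv> generator l u g (z x) f x"

abbreviation rate :: "nat ^ 'm \<Rightarrow> nat ^ 'm \<Rightarrow> real" where
  "rate \<equiv> policy_rates l u g z"

lemma gen_eq: "gen f x = (\<Sum>i\<in>UNIV. l $ i * (f (x + axis i 1) - f x))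
    + (\<Sum>i\<in>UNIV. departure x i * (f (x - axis i 1) - f x))"
  by (simp add: generator_def departure_def)

lemma z_le: "z x $ i \<le> x $ i"
  using policy by (auto simp: wc_policy_def wc_actions_def)

lemma departure_ge: "c * real (x $ i) \<le> departure x i"
proof -
  have "c * real (z x $ i) + c * (real (x $ i) - real (z x $ i)) \<le> departure x i"
    unfolding departure_def using z_le[of x i] c_le by (intro add_mono mult_right_mono) auto
  then show ?thesis by (simp add: algebra_simps)
qed

lemma departure_le: "departure x i \<le> D * real (x $ i)"
proof -
  have "departure x i \<le> D * real (z x $ i) + D * (real (x $ i) - real (z x $ i))"
    unfolding departure_def using z_le[of x i] le_D by (intro add_mono mult_right_mono) auto
  then show ?thesis by (simp add: algebra_simps)
qed

lemma departure_nonneg: "0 \<le> departure x i"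
  using departure_ge[of x i] c_pos by (meson mult_nonneg_nonneg of_nat_0_le_iff order.strict_implies_order order_trans)

lemma departure_zero: "x $ i = 0 \<Longrightarrow> departure x i = 0"
  using departure_le[of x i] departure_nonneg[of x i] by simp

lemma rate_eq: "rate x y = (\<Sum>i\<in>UNIV. l $ i * (indicator {y} (x + axis i 1) - indicator {y} x))
    + (\<Sum>i\<in>UNIV. departure x i * (indicator {y} (x - axis i 1) - indicator {y} x))"
  unfolding policy_rates_def by (rule gen_eq)

lemma rate_diag_nonpos: "rate x x \<le> 0"
  unfolding rate_eq using l_nonneg departure_nonneg
  by (intro add_nonpos_nonpos sum_nonpos mult_nonneg_nonpos) (auto simp: indicator_def)

lemma rate_nonneg: "x \<noteq> y \<Longrightarrow> 0 \<le> rate x y"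
  unfolding rate_eq using l_nonneg departure_nonneg
  by (intro add_nonneg_nonneg sum_nonneg mult_nonneg_nonneg) (auto simp: indicator_def)

text \<open>Rates are the generator on indicators. On the finite set of states within one step
  \<open>f\<close> is a combination of indicators, so linearity returns the generator of
  \<open>f\<close>; removing the diagonal leaves the jump part, a sum of nonnegative terms.\<close>

lemma nn_integral_rate:
  assumes f: "\<And>w. 0 \<le> f w"
  shows "(\<integral>\<^sup>+ w. ennreal (rate x w) * ennreal (f w) \<partial>count_space (- {x}))
      = ennreal (gen f x - rate x x * f x)"
    and "0 \<le> gen f x - rate x x * f x"
proof -
  \<comment> \<open>Truncated subtraction may return \<open>x\<close> itself at an empty class;
    including \<open>x\<close> in \<open>B\<close> covers this case too.\<close>
  define B where "B = insert x (range (\<lambda>i. x + axis i 1) \<union> range (\<lambda>i. x - axis i 1))"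
  have B: "finite B" "x \<in> B" "x + axis i 1 \<in> B" "x - axis i 1 \<in> B" for i
    by (auto simp: B_def)
  have ind: "(\<Sum>w\<in>B. indicator {w} y * f w) = f y" if "y \<in> B" for y
  proof -
    have "(\<Sum>w\<in>B. indicator {w} y * f w) = (\<Sum>w\<in>B. if y = w then f w else 0)"
      by (intro sum.cong) (auto simp: indicator_def)
    then show ?thesis using B(1) that by simp
  qed
  have diff: "(\<Sum>w\<in>B. (indicator {w} y - indicator {w} x) * f w) = f y - f x" if "y \<in> B" for y
    by (simp only: left_diff_distrib sum_subtractf ind that B)
  have "(\<Sum>w\<in>B. rate x w * f w)
      = (\<Sum>w\<in>B. \<Sum>i\<in>UNIV. l $ i * ((indicator {w} (x + axis i 1) - indicator {w} x) * f w))
      + (\<Sum>w\<in>B. \<Sum>i\<in>UNIV. departure x i * ((indicator {w} (x - axis i 1) - indicator {w} x) * f w))"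
    by (simp add: rate_eq distrib_right sum_distrib_right sum.distrib mult.assoc)
  also have "\<dots> = gen f x"
    unfolding gen_eq
    by (subst (1 2) sum.swap) (simp only: sum_distrib_left[symmetric] diff B)
  finally have sumB: "(\<Sum>w\<in>B. rate x w * f w) = gen f x" .
  have sumBx: "(\<Sum>w\<in>B - {x}. rate x w * f w) = gen f x - rate x x * f x"
    using B(1,2) sumB by (simp add: sum_diff1)
  then show "0 \<le> gen f x - rate x x * f x"
    using f by (subst sumBx[symmetric], intro sum_nonneg mult_nonneg_nonneg rate_nonneg) auto
  have zero: "rate x w = 0" if "w \<notin> B" for w
  proof -
    have "w \<noteq> x" "w \<noteq> x + axis i 1" "w \<noteq> x - axis i 1" for i
      using that B by blast+
    then have "indicator {w} x = (0::real)" "indicator {w} (x + axis i 1) = (0::real)"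
      "indicator {w} (x - axis i 1) = (0::real)" for i
      by (metis indicator_simps(2) singletonD)+
    then show ?thesis unfolding rate_eq by simp
  qed
  have "(\<integral>\<^sup>+ w. ennreal (rate x w) * ennreal (f w) \<partial>count_space (- {x}))
      = (\<integral>\<^sup>+ w. ennreal (rate x w * f w) \<partial>count_space (B - {x}))"
    by (subst (1 2) nn_integral_count_space_indicator)
       (auto simp: indicator_def zero ennreal_mult rate_nonneg f intro!: nn_integral_cong)
  also have "\<dots> = ennreal (\<Sum>w\<in>B - {x}. rate x w * f w)"
    using B(1) f by (subst nn_integral_count_space_finite)
      (auto intro!: sum_ennreal mult_nonneg_nonneg rate_nonneg)
  finally show "(\<integral>\<^sup>+ w. ennreal (rate x w) * ennreal (f w) \<partial>count_space (- {x}))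
      = ennreal (gen f x - rate x x * f x)"
    unfolding sumBx .
qed

lemma gen_const: "gen (\<lambda>_. b) x = 0"
  by (simp add: gen_eq)

lemma gen_affine: "gen (\<lambda>x. a * f x + b) x = a * gen f x"
proof -
  have "(a * f y + b) - (a * f x + b) = a * (f y - f x)" for y
    by (simp add: algebra_simps)
  then show ?thesis
    unfolding gen_eq distrib_left sum_distrib_left by (simp only: mult.left_commute)
qed

sublocale conservative_rates "policy_rates l u g z"
proof
  fix x
  show "(\<integral>\<^sup>+ w. ennreal (rate x w) \<partial>count_space (- {x})) = ennreal (- rate x x)"
    using nn_integral_rate(1)[of "\<lambda>_. 1" x] by (simp add: gen_const)
  show "rate x x \<le> 0" by (rule rate_diag_nonpos)
qed

lemma jump_eq_gen:
  assumes "\<And>w. 0 \<le> f w"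
  shows "jump (\<lambda>w. ennreal (f w)) x = ennreal (gen f x - rate x x * f x)"
  unfolding jump_def by (rule nn_integral_rate(1)[OF assms])

text \<open>Linear growth of the total jump rate in the head count is what rules out
  explosion.\<close>

lemma rate_diag_ge: "- rate x x \<le> (\<Sum>i\<in>UNIV. l $ i) + D * real (head_count x)"
proof -
  have "- rate x x = (\<Sum>i\<in>UNIV. l $ i * (1 - indicator {x} (x + axis i 1)))
      + (\<Sum>i\<in>UNIV. departure x i * (1 - indicator {x} (x - axis i 1)))"
    unfolding rate_eq by (simp add: sum_negf[symmetric] algebra_simps)
  also have "\<dots> \<le> (\<Sum>i\<in>UNIV. l $ i) + (\<Sum>i\<in>UNIV. D * real (x $ i))"
    using l_nonneg departure_nonneg
    by (intro add_mono sum_mono mult_left_le order_trans[OF mult_left_le departure_le])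
       (auto simp: indicator_def)
  finally show ?thesis by (simp add: head_count_def sum_distrib_left)
qed

lemma honest_queue:
  assumes "0 \<le> t"
  shows "expect (\<lambda>_. 1) t x = 1"
proof (rule expect_one[OF _ assms])
  define L where "L = (\<Sum>i\<in>UNIV. l $ i)"
  define A where "A = max L D"
  have L: "0 \<le> L" unfolding L_def by (intro sum_nonneg l_nonneg)
  then have A: "0 \<le> A" "L \<le> A" "D \<le> A" by (auto simp: A_def)
  \<comment> \<open>At time \<open>s\<close> the mean head count is at most
    \<open>head_count x + L * s\<close>, and jumps occur at rate at most \<open>A\<close> times one
    plus the head count. Integrating up to \<open>t\<close> gives a bound below \<open>v\<close>,
    whose slightly larger quadratic term keeps the formula simple.\<close>
  define v where "v t x = A * t * (1 + real (head_count x) + L * t)" for t and x :: "nat ^ 'm"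
  define v' where "v' t x = A * (1 + real (head_count x) + 2 * L * t)" for t and x :: "nat ^ 'm"
  fix t :: real and x :: "nat ^ 'm" assume t: "0 \<le> t"
  have v_nonneg: "0 \<le> v t x" if "0 \<le> t" for t x
    unfolding v_def using that A L by (intro mult_nonneg_nonneg add_nonneg_nonneg) auto
  have gen_v: "gen (v t) x \<le> A * t * L" if "0 \<le> t" for t x
  proof -
    have "gen (v t) x = gen (\<lambda>x. (A * t) * real (head_count x) + A * t * (1 + L * t)) x"
      by (rule arg_cong[where f = "\<lambda>f. gen f x"]) (simp add: v_def fun_eq_iff algebra_simps)
    also have "\<dots> = A * t * gen (\<lambda>x. real (head_count x)) x"
      by (rule gen_affine)
    also have "gen (\<lambda>x. real (head_count x)) x \<le> L + 0"
      unfolding gen_eq L_def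
    proof (intro add_mono sum_nonpos sum_mono)
      fix i
      show "departure x i * (real (head_count (x - axis i 1)) - real (head_count x)) \<le> 0"
        using head_count_minus_axis[of x i] departure_nonneg[of x i]
        by (cases "x $ i = 0") (auto simp: vec_minus_axis_zero intro!: mult_nonneg_nonpos)
    qed (simp add: head_count_plus_axis)
    finally show ?thesis using A that by (simp add: mult_left_mono)
  qed
  have key: "gen (v t) x - rate x x \<le> v' t x" if "0 \<le> t" for t
  proof -
    have "- rate x x \<le> L + D * real (head_count x)"
      using rate_diag_ge[of x] by (simp add: L_def)
    also have "\<dots> \<le> A + A * real (head_count x)"
      using A by (intro add_mono mult_right_mono) auto
    finally have "gen (v t) x - rate x x \<le> A * t * L + (A + A * real (head_count x))"
      using gen_v[OF that, of x] by linarith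
    also have "\<dots> \<le> v' t x"
      using A L that by (simp add: v'_def algebra_simps)
    finally show ?thesis .
  qed
  \<comment> \<open>Here \<open>supersolution\<close> is used with \<open>h = 1\<close>, which
    counts the jump being made; \<open>v\<close> vanishes at time 0.\<close>
  have "ennreal (exp (rate x x * t)) * ennreal (v 0 x)
      + first_jump (\<lambda>t y. 1 + ennreal (v t y)) t x \<le> ennreal (v t x)"
  proof (rule supersolution[where w' = v', OF _ _ _ _ _ _ t])
    show "((\<lambda>t. v t x) has_real_derivative v' t x) (at t)" for t
      unfolding v_def v'_def by (auto intro!: derivative_eq_intros simp: algebra_simps)
    show "(\<lambda>t. v t x) \<in> borel_measurable borel" "(\<lambda>t. v' t x) \<in> borel_measurable borel"
      unfolding v_def v'_def by measurable
    show "0 \<le> v t x" if "0 \<le> t" for t x by (rule v_nonneg[OF that])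
    fix t :: real assume t: "0 \<le> t"
    have g1: "gen (\<lambda>y. 1 + v t y) x = gen (v t) x"
      using gen_affine[where a = 1 and f = "v t" and b = 1 and x = x] by (simp add: add.commute)
    have "jump (\<lambda>y. 1 + ennreal (v t y)) x = jump (\<lambda>y. ennreal (1 + v t y)) x"
      using v_nonneg[OF t] by (simp add: ennreal_plus[symmetric] del: ennreal_plus flip: ennreal_1)
    also have "\<dots> = ennreal (gen (v t) x - rate x x * (1 + v t x))"
      using v_nonneg[OF t] by (subst jump_eq_gen) (auto simp: g1)
    also have "\<dots> \<le> ennreal (v' t x - rate x x * v t x)"
      using key[OF t] by (intro ennreal_leI) (simp add: algebra_simps)
    finally show "jump (\<lambda>y. 1 + ennreal (v t y)) x \<le> ennreal (v' t x - rate x x * v t x)" .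
    have "0 \<le> gen (v t) x - rate x x * v t x"
      using v_nonneg[OF t] by (intro nn_integral_rate(2))
    then show "0 \<le> v' t x - rate x x * v t x"
      using key[OF t] rate_diag_nonpos[of x] by linarith
  qed
  then show "first_jump (\<lambda>t y. 1 + ennreal (v t y)) t x \<le> ennreal (v t x)"
    by (simp add: v_def)
qed

sublocale honest_rates "policy_rates l u g z"
  by unfold_locales (rule honest_queue)

section \<open>Exponential moments and the stationary law of the queue\<close>

lemma gen_exp_head_count_le:
  assumes a: "0 < a"
  obtains K where "0 \<le> K"
    and "\<And>x. gen (\<lambda>x. exp (a * real (head_count x))) x \<le> K - exp (a * real (head_count x))"
proof -
  define L where "L = (\<Sum>i\<in>UNIV. l $ i)"
  define b where "b = (1 - exp (- a)) * c"
  \<comment> \<open>The arrival part of the generator is \<open>L * (exp a - 1)\<close> times the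
    test function; the extra 1 makes room for the unit decay rate. Departures contribute
    \<open>- b\<close> per customer, so with more than \<open>B / b\<close> customers the bracket is
    negative, and otherwise everything is bounded.\<close>
  define B where "B = L * (exp a - 1) + 1"
  have b: "0 < b" unfolding b_def using a c_pos by simp
  have "0 \<le> L" unfolding L_def by (intro sum_nonneg l_nonneg)
  then have B: "0 \<le> B" unfolding B_def using a by simp
  let ?V = "\<lambda>x. exp (a * real (head_count x))"
  show ?thesis
  proof (rule that)
    show "0 \<le> B * exp (a * (B / b))" using B by simp
    fix x
    have up: "(\<Sum>i\<in>UNIV. l $ i * (?V (x + axis i 1) - ?V x)) = L * (exp a - 1) * ?V x"
      unfolding L_def
      by (simp add: head_count_plus_axis sum_distrib_right distrib_left exp_add
            right_diff_distrib left_diff_distrib sum_subtractf sum_distrib_left mult_ac)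
    have "(\<Sum>i\<in>UNIV. departure x i * (?V (x - axis i 1) - ?V x))
        = (\<Sum>i\<in>UNIV. - (departure x i * ((1 - exp (- a)) * ?V x)))"
    proof (intro sum.cong refl)
      fix i
      show "departure x i * (?V (x - axis i 1) - ?V x) = - (departure x i * ((1 - exp (- a)) * ?V x))"
      proof (cases "x $ i = 0")
        case True
        then show ?thesis by (simp add: departure_zero)
      next
        case False
        then have "real (head_count (x - axis i 1)) = real (head_count x) - 1"
          using head_count_minus_axis[of x i] by simp
        then have "?V (x - axis i 1) = exp (- a) * ?V x"
          by (simp add: exp_add[symmetric] right_diff_distrib)
        then show ?thesis by (simp add: algebra_simps)
      qed
    qed
    also have "\<dots> \<le> (\<Sum>i\<in>UNIV. - (c * real (x $ i) * ((1 - exp (- a)) * ?V x)))"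
      using a by (intro sum_mono le_imp_neg_le mult_right_mono departure_ge) auto
    also have "\<dots> = - (b * real (head_count x) * ?V x)"
      by (simp add: b_def head_count_def sum_negf sum_distrib_left sum_distrib_right mult_ac)
    finally have "gen ?V x + ?V x \<le> ?V x * (B - b * real (head_count x))"
      unfolding gen_eq up B_def by (simp add: algebra_simps)
    also have "\<dots> \<le> B * exp (a * (B / b))"
    proof (cases "real (head_count x) \<le> B / b")
      case True
      have "?V x * (B - b * real (head_count x)) \<le> exp (a * (B / b)) * B"
        using True a b B by (intro mult_mono') (auto simp: mult_left_mono field_simps)
      then show ?thesis by (simp add: mult.commute)
    next
      case False
      then have "B - b * real (head_count x) \<le> 0"
        using b by (simp add: field_simps)
      then have "?V x * (B - b * real (head_count x)) \<le> 0"
        by (intro mult_nonneg_nonpos) auto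
      also have "0 \<le> B * exp (a * (B / b))" using B by simp
      finally show ?thesis .
    qed
    finally show "gen ?V x \<le> B * exp (a * (B / b)) - ?V x" by simp
  qed
qed

lemma expect_exp_head_count_le:
  assumes a: "0 < a"
  obtains K where "0 \<le> K"
    and "\<And>t x. 0 \<le> t \<Longrightarrow> expect (\<lambda>x. ennreal (exp (a * real (head_count x)))) t x
      \<le> ennreal (exp (- t) * exp (a * real (head_count x)) + K)"
proof -
  let ?V = "\<lambda>x. exp (a * real (head_count x))"
  obtain K where K: "0 \<le> K" "\<And>x. gen ?V x \<le> K - ?V x"
    using gen_exp_head_count_le[OF a] by blast
  \<comment> \<open>Solution of \<open>w' = K - w\<close> started at the test function; the
    generator bound makes it an upper solution of the backward equation.\<close>
  define w where "w t x = exp (- t) * ?V x + K * (1 - exp (- t))" for t and x :: "nat ^ 'm"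
  define w' where "w' t x = exp (- t) * (K - ?V x)" for t and x :: "nat ^ 'm"
  have w_nonneg: "0 \<le> w t x" if "0 \<le> t" for t x
    unfolding w_def using that K by (intro add_nonneg_nonneg mult_nonneg_nonneg) auto
  have gen_w: "gen (w t) x \<le> w' t x" for t x
  proof -
    have "gen (w t) x = exp (- t) * gen ?V x"
      unfolding w_def by (rule gen_affine)
    then show ?thesis using K(2)[of x] by (simp add: w'_def)
  qed
  have "expect (\<lambda>x. ennreal (?V x)) t x \<le> ennreal (w t x)" if "0 \<le> t" for t x
  proof (rule expect_minimal[OF _ that])
    fix t :: real and x :: "nat ^ 'm" assume t: "0 \<le> t"
    have "ennreal (exp (rate x x * t)) * ennreal (w 0 x)
        + first_jump (\<lambda>t y. 0 + ennreal (w t y)) t x \<le> ennreal (w t x)"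
    proof (rule supersolution[where w' = w', OF _ _ _ _ _ _ t])
      show "((\<lambda>t. w t x) has_real_derivative w' t x) (at t)" for t
        unfolding w_def w'_def by (auto intro!: derivative_eq_intros simp: algebra_simps)
      show "(\<lambda>t. w t x) \<in> borel_measurable borel" "(\<lambda>t. w' t x) \<in> borel_measurable borel"
        unfolding w_def w'_def by measurable
      show "0 \<le> w t x" if "0 \<le> t" for t x by (rule w_nonneg[OF that])
      fix t :: real assume t: "0 \<le> t"
      show "jump (\<lambda>y. 0 + ennreal (w t y)) x \<le> ennreal (w' t x - rate x x * w t x)"
        using w_nonneg[OF t] gen_w[of x t] by (simp add: jump_eq_gen ennreal_leI)
      have "0 \<le> gen (w t) x - rate x x * w t x"
        using w_nonneg[OF t] by (intro nn_integral_rate(2))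
      then show "0 \<le> w' t x - rate x x * w t x"
        using gen_w[of x t] by linarith
    qed
    then show "ennreal (exp (rate x x * t)) * ennreal (?V x)
        + first_jump (\<lambda>t y. ennreal (w t y)) t x \<le> ennreal (w t x)"
      by (simp add: w_def)
  qed
  moreover have "ennreal (w t x) \<le> ennreal (exp (- t) * ?V x + K)" for t x
    unfolding w_def using K(1) by (intro ennreal_leI) (simp add: algebra_simps)
  ultimately show ?thesis
    using K(1) by (intro that[of K]) (assumption, meson order_trans)
qed

text \<open>From any nonempty state some departure has positive rate and lowers the head count, so
  induction on the head count, with time left arbitrary, reaches the empty state.\<close>

lemma transition_empty_pos:
  assumes "0 < t"
  shows "0 < transition rate t x 0"
  using assms
proof (induction "head_count x" arbitrary: x t rule: less_induct)
  case less
  show ?case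
  proof (cases "x = 0")
    case True
    then show ?thesis by (simp add: transition_refl_pos)
  next
    case False
    then obtain i where i: "0 < x $ i" by (auto simp: vec_eq_iff)
    let ?w = "x - axis i 1"
    have smaller: "head_count ?w < head_count x"
      using head_count_minus_axis[of x i, OF i] by simp
    have ne: "x \<noteq> ?w" using smaller by auto
    have "0 < c * real (x $ i)" using i c_pos by simp
    then have "0 < departure x i" using departure_ge[of x i] by linarith
    also have "departure x i = departure x i * (indicator {?w} (x - axis i 1) - indicator {?w} x)"
      using ne by (simp add: indicator_def)
    also have "\<dots> \<le> (\<Sum>j\<in>UNIV. departure x j * (indicator {?w} (x - axis j 1) - indicator {?w} x))"
      using ne departure_nonneg by (intro member_le_sum) (auto simp: indicator_def)
    also have "\<dots> \<le> rate x ?w"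
      unfolding rate_eq using ne l_nonneg by (auto simp: indicator_def intro!: sum_nonneg)
    finally show ?thesis
      by (rule transition_step_pos[OF _ ne less.hyps[OF smaller] less.prems])
  qed
qed

text \<open>A stationary law is invariant at every integer time \<open>k\<close>, where the initial
  value enters with factor \<open>exp (- k)\<close>; letting \<open>k\<close> grow leaves only
  \<open>K\<close>.\<close>

lemma stationary_exp_head_count:
  assumes "stationary rate \<pi>" and a: "0 < a"
  shows "(\<integral>\<^sup>+ x. ennreal (exp (a * real (head_count x))) \<partial>measure_pmf \<pi>) < \<infinity>"
proof -
  obtain K where K: "0 \<le> K" "\<And>t x. 0 \<le> t \<Longrightarrow>
      expect (\<lambda>x. ennreal (exp (a * real (head_count x)))) t x
      \<le> ennreal (exp (- t) * exp (a * real (head_count x)) + K)"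
    using expect_exp_head_count_le[OF a] by blast
  have lim: "(\<lambda>k. exp (- real k)) \<longlonglongrightarrow> 0"
    by (rule filterlim_compose[OF exp_at_bot])
       (simp add: filterlim_uminus_at_bot filterlim_real_sequentially)
  have "(\<integral>\<^sup>+ x. ennreal (exp (a * real (head_count x))) \<partial>measure_pmf \<pi>) \<le> ennreal K"
    by (rule nn_integral_invariant_le[where K = "\<lambda>k. kernel (real k)", OF _ _ K(1) lim])
       (use assms(1) in \<open>auto simp: stationary_iff_kernel nn_integral_kernel K(2)\<close>)
  also have "\<dots> < \<infinity>" by simp
  finally show ?thesis .
qed

text \<open>The discrete-time results apply to the skeleton \<open>kernel 1\<close>. Its uniqueness
  statement serves twice: for uniqueness itself, and to promote invariance at time 1 to all
  times.\<close>

lemma stationary_exists_unique: "\<exists>!\<pi>. stationary rate \<pi>"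
proof (rule ex_ex1I)
  have pos: "0 < pmf (kernel 1 x) 0" for x
    using transition_empty_pos[of 1 x] by (simp flip: ennreal_pmf_kernel)
  note unique = invariant_pmf_unique[where K = "kernel 1", OF pos]
  show "\<pi> = \<pi>'" if "stationary rate \<pi>" "stationary rate \<pi>'" for \<pi> \<pi>'
    by (rule unique) (use that in \<open>auto simp: stationary_iff_kernel\<close>)
  obtain K where K: "0 \<le> K" "\<And>t x. 0 \<le> t \<Longrightarrow>
      expect (\<lambda>x. ennreal (exp (1 * real (head_count x)))) t x
      \<le> ennreal (exp (- t) * exp (1 * real (head_count x)) + K)"
    using expect_exp_head_count_le[OF zero_less_one] by blast
  have "\<exists>\<pi>. bind_pmf \<pi> (kernel 1) = \<pi>"
  proof (rule invariant_pmf_exists[where \<mu> = "\<lambda>k. kernel (real k) 0"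
        and V = "\<lambda>x. exp (real (head_count x))" and C = "1 + K"])
    show "kernel (real (Suc k)) 0 = bind_pmf (kernel (real k) 0) (kernel 1)" for k
      using kernel_add[of "real k" 1 0] by (simp add: add.commute)
    show "finite {x :: nat ^ 'm. exp (real (head_count x)) \<le> R}" for R
    proof (rule finite_subset[OF _ finite_head_count_le[of "nat \<lceil>R\<rceil>"]], rule subsetI)
      fix x :: "nat ^ 'm" assume "x \<in> {x. exp (real (head_count x)) \<le> R}"
      then have "exp (real (head_count x)) \<le> R" by simp
      moreover have "real (head_count x) < exp (real (head_count x))"
        using exp_ge_add_one_self[of "real (head_count x)"] by linarith
      ultimately have "real (head_count x) \<le> real_of_int \<lceil>R\<rceil>" by linarith
      then show "x \<in> {x. head_count x \<le> nat \<lceil>R\<rceil>}" by (simp add: le_nat_iff)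
    qed
    show "(\<integral>\<^sup>+ x. ennreal (exp (real (head_count x))) \<partial>measure_pmf (kernel (real k) 0)) \<le> ennreal (1 + K)"
      for k
    proof -
      have "(\<integral>\<^sup>+ x. ennreal (exp (real (head_count x))) \<partial>measure_pmf (kernel (real k) 0))
          \<le> ennreal (exp (- real k) * exp (real (head_count (0 :: nat ^ 'm))) + K)"
        using K(2)[of "real k" 0] by (simp add: nn_integral_kernel)
      also have "\<dots> \<le> ennreal (1 + K)"
        by (intro ennreal_leI) (simp add: head_count_def)
      finally show ?thesis .
    qed
    show "0 \<le> 1 + K" using K(1) by simp
  qed
  then obtain \<pi> where \<pi>: "bind_pmf \<pi> (kernel 1) = \<pi>" ..
  txt \<open>The image of \<open>\<pi>\<close> under \<open>kernel t\<close> is again \<open>kernel 1\<close>-invariant, because the kernels commute.\<close>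
  have "bind_pmf \<pi> (kernel t) = \<pi>" if t: "0 \<le> t" for t
  proof (rule unique[OF _ \<pi>])
    have "bind_pmf (bind_pmf \<pi> (kernel t)) (kernel 1) = bind_pmf \<pi> (\<lambda>x. kernel (t + 1) x)"
      using t by (simp add: bind_assoc_pmf kernel_add)
    also have "\<dots> = bind_pmf (bind_pmf \<pi> (kernel 1)) (kernel t)"
      using t by (simp add: bind_assoc_pmf kernel_add add.commute)
    finally show "bind_pmf (bind_pmf \<pi> (kernel t)) (kernel 1) = bind_pmf \<pi> (kernel t)"
      by (simp add: \<pi>)
  qed
  then show "\<exists>\<pi>. stationary rate \<pi>"
    by (auto simp: stationary_iff_kernel)
qed

text \<open>At a fixed level \<open>norm1\<close> of the scaled state is at most the head count
  divided by \<open>sqrt n\<close> plus a constant, and exponential moments of the head count exist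
  at every rate.\<close>

lemma stationary_exp_norm1_integrable:
  assumes st: "stationary rate \<pi>" and \<eta>: "0 < \<eta>" and n: "0 < n"
  shows "integrable (measure_pmf (map_pmf (xhat n l u) \<pi>)) (\<lambda>y. exp (\<eta> * norm1 y))"
proof -
  define a where "a = \<eta> / sqrt (real n)"
  define r where "r i = \<bar>l $ i / u $ i / sqrt (real n)\<bar> + \<bar>varrho n l u / real CARD('m)\<bar>" for i
  have a: "0 < a" using \<eta> n by (simp add: a_def)
  have norm: "\<eta> * norm1 (xhat n l u x) \<le> a * real (head_count x) + \<eta> * (\<Sum>i\<in>UNIV. r i)" for x
  proof -
    have "norm1 (xhat n l u x) \<le> (\<Sum>i\<in>UNIV. real (x $ i) / sqrt (real n) + r i)"
      unfolding norm1_def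
    proof (intro sum_mono)
      fix i
      have "xhat n l u x $ i = real (x $ i) / sqrt (real n) - l $ i / u $ i / sqrt (real n)
          - varrho n l u / real CARD('m)"
        by (simp add: xhat_def diff_divide_distrib)
      moreover have "0 \<le> real (x $ i) / sqrt (real n)" by simp
      ultimately show "\<bar>xhat n l u x $ i\<bar> \<le> real (x $ i) / sqrt (real n) + r i"
        unfolding r_def by linarith
    qed
    also have "\<dots> = real (head_count x) / sqrt (real n) + (\<Sum>i\<in>UNIV. r i)"
      by (simp add: sum.distrib head_count_def sum_divide_distrib)
    finally have "\<eta> * norm1 (xhat n l u x)
        \<le> \<eta> * (real (head_count x) / sqrt (real n) + (\<Sum>i\<in>UNIV. r i))"
      using \<eta> by (intro mult_left_mono) auto
    then show ?thesis by (simp add: a_def algebra_simps)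
  qed
  have "integrable (measure_pmf \<pi>) (\<lambda>x. exp (\<eta> * norm1 (xhat n l u x)))"
  proof (rule Bochner_Integration.integrable_bound)
    have "integrable (measure_pmf \<pi>) (\<lambda>x. exp (a * real (head_count x)))"
      using stationary_exp_head_count[OF st a] by (simp add: integrable_iff_bounded)
    then show "integrable (measure_pmf \<pi>)
        (\<lambda>x. exp (\<eta> * (\<Sum>i\<in>UNIV. r i)) * exp (a * real (head_count x)))"
      by simp
    show "AE x in measure_pmf \<pi>. norm (exp (\<eta> * norm1 (xhat n l u x)))
        \<le> norm (exp (\<eta> * (\<Sum>i\<in>UNIV. r i)) * exp (a * real (head_count x)))"
      using norm by (simp add: exp_add[symmetric] add.commute)
  qed simp
  then show ?thesis by simp
qed

end

section \<open>The Lyapunov function and its drift\<close>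

text \<open>Used to glue the branches of \<open>psi\<close> at the breakpoints -1 and 0.\<close>

lemma has_real_derivative_split:
  assumes "(f has_real_derivative d) (at x within {..x})" "(f has_real_derivative d) (at x within {x..})"
  shows "(f has_real_derivative d) (at x)"
proof -
  have "(f has_real_derivative d) (at_left x)" "(f has_real_derivative d) (at_right x)"
    by (rule has_field_derivative_subset[OF assms(1)], auto,
        rule has_field_derivative_subset[OF assms(2)], auto)
  then show ?thesis
    unfolding has_field_derivative_iff by (rule filterlim_split_at)
qed

definition unit_clamp :: "real \<Rightarrow> real" where
  "unit_clamp s = max 0 (min 1 s)"

text \<open>With \<open>s = t + 1\<close> the quartic branch of \<open>psi\<close> has derivative
  \<open>3 * s ^ 2 - 2 * s ^ 3\<close>, which runs from 0 to 1. Clamping \<open>s\<close> to the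
  unit interval gives the slopes 0 and 1 of the outer branches by the same formula.\<close>

definition dpsi :: "real \<Rightarrow> real" where
  "dpsi t = 3 * unit_clamp (t + 1) ^ 2 - 2 * unit_clamp (t + 1) ^ 3"

lemma dpsi_bounds: "0 \<le> dpsi t" "dpsi t \<le> 1"
proof -
  define s where "s = unit_clamp (t + 1)"
  have s: "0 \<le> s" "s \<le> 1" by (auto simp: s_def unit_clamp_def)
  have "dpsi t = s ^ 2 * (3 - 2 * s)"
    unfolding dpsi_def s_def by (simp add: power2_eq_square power3_eq_cube algebra_simps)
  then show "0 \<le> dpsi t" using s by simp
  have "1 - dpsi t = (1 - s) ^ 2 * (1 + 2 * s)"
    unfolding dpsi_def s_def by (simp add: power2_eq_square power3_eq_cube algebra_simps)
  moreover have "0 \<le> (1 - s) ^ 2 * (1 + 2 * s)" using s by simp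
  ultimately show "dpsi t \<le> 1" by linarith
qed

lemma dpsi_eq_one: "0 \<le> t \<Longrightarrow> dpsi t = 1"
  by (simp add: dpsi_def unit_clamp_def)

lemma dpsi_eq_zero: "t \<le> - 1 \<Longrightarrow> dpsi t = 0"
  by (simp add: dpsi_def unit_clamp_def)

text \<open>Clamping is nonexpansive and the difference of the cubics factors through
  \<open>s' - s\<close>. The constant 12 is crude; a Lipschitz slope suffices for the second-order
  expansion.\<close>

lemma dpsi_lipschitz: "\<bar>dpsi t' - dpsi t\<bar> \<le> 12 * \<bar>t' - t\<bar>"
proof -
  define s s' where "s = unit_clamp (t + 1)" and "s' = unit_clamp (t' + 1)"
  have s: "0 \<le> s" "s \<le> 1" "0 \<le> s'" "s' \<le> 1" and diff: "\<bar>s' - s\<bar> \<le> \<bar>t' - t\<bar>"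
    by (auto simp: s_def s'_def unit_clamp_def)
  have "dpsi t' - dpsi t = (s' - s) * (3 * (s' + s) - 2 * (s' * s' + s' * s + s * s))"
    unfolding dpsi_def s_def s'_def by (simp add: power2_eq_square power3_eq_cube algebra_simps)
  moreover have "\<bar>3 * (s' + s) - 2 * (s' * s' + s' * s + s * s)\<bar> \<le> 12"
  proof -
    have "s' * s' \<le> 1" "s' * s \<le> 1" "s * s \<le> 1" "0 \<le> s' * s'" "0 \<le> s' * s" "0 \<le> s * s"
      using s by (auto intro: mult_le_one)
    then show ?thesis unfolding abs_le_iff distrib_left using s by (intro conjI; linarith)
  qed
  ultimately have "\<bar>dpsi t' - dpsi t\<bar> \<le> \<bar>s' - s\<bar> * 12"
    by (simp add: abs_mult mult_left_mono)
  also have "\<dots> \<le> \<bar>t' - t\<bar> * 12" using diff by (rule mult_right_mono) simp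
  finally show ?thesis by (simp only: mult.commute)
qed

lemma psi_has_derivative: "(psi has_real_derivative dpsi t) (at t)"
proof -
  let ?p = "\<lambda>t::real. (t + 1) ^ 3 - (t + 1) ^ 4 / 2 - 1 / 2"
  have const: "(psi has_real_derivative dpsi t) (at t within {..- 1})" if "t \<le> - 1" for t
  proof (rule has_field_derivative_transform_within[where d = 1 and f = "\<lambda>_. - 1 / 2"])
    show "((\<lambda>_. - 1 / 2) has_real_derivative dpsi t) (at t within {..- 1})"
      using that by (auto simp: dpsi_eq_zero)
  qed (use that in \<open>auto simp: psi_def\<close>)
  have mid: "(psi has_real_derivative dpsi t) (at t within {- 1..0})" if "- 1 \<le> t" "t \<le> 0" for t
  proof (rule has_field_derivative_transform_within[where d = 1 and f = ?p])
    have "unit_clamp (t + 1) = t + 1" using that by (simp add: unit_clamp_def)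
    then show "(?p has_real_derivative dpsi t) (at t within {- 1..0})"
      unfolding dpsi_def by (auto intro!: derivative_eq_intros simp: algebra_simps power2_eq_square power3_eq_cube)
  qed (use that in \<open>auto simp: psi_def\<close>)
  have lin: "(psi has_real_derivative dpsi t) (at t within {0..})" if "0 \<le> t" for t
  proof (rule has_field_derivative_transform_within[where d = 1 and f = "\<lambda>t. t"])
    show "((\<lambda>t. t) has_real_derivative dpsi t) (at t within {0..})"
      using that by (auto simp: dpsi_eq_one intro!: derivative_eq_intros)
  qed (use that in \<open>auto simp: psi_def\<close>)
  consider "t < - 1" | "t = - 1" | "- 1 < t" "t < 0" | "t = 0" | "0 < t" by linarith
  then show ?thesis
  proof cases
    case 1
    have "at t within {..- 1} = at t" by (rule at_within_interior) (use 1 in simp)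
    then show ?thesis using const[of t] 1 by simp
  next
    case 2
    have "(psi has_real_derivative dpsi t) (at t within {t..})"
      using mid[of t] 2 at_within_Icc_at_right[of "- 1" "0::real"] at_within_Ici_at_right[of t] by simp
    then show ?thesis using const[of t] 2 by (intro has_real_derivative_split) auto
  next
    case 3
    have "at t within {- 1..0} = at t" by (rule at_within_interior) (use 3 in simp)
    then show ?thesis using mid[of t] 3 by simp
  next
    case 4
    have "(psi has_real_derivative dpsi t) (at t within {..t})"
      using mid[of t] 4 at_within_Icc_at_left[of "- 1" "0::real"] at_within_Iic_at_left[of t] by simp
    then show ?thesis using lin[of t] 4 by (intro has_real_derivative_split) auto
  next
    case 5
    have "at t within {0..} = at t" by (rule at_within_interior) (use 5 in simp)
    then show ?thesis using lin[of t] 5 by simp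
  qed
qed

lemma psi_le_abs: "psi t \<le> \<bar>t\<bar>"
proof (cases "t \<le> 0")
  case True
  have "psi t \<le> psi 0"
    using True psi_has_derivative dpsi_bounds(1)
    by (intro DERIV_nonneg_imp_nondecreasing[of t 0 psi]) blast+
  then show ?thesis by (simp add: psi_def)
qed (simp add: psi_def)

definition phi :: "real \<Rightarrow> real \<Rightarrow> real" where
  "phi \<theta> t = \<theta> * psi (- t) + psi t"

definition dphi :: "real \<Rightarrow> real \<Rightarrow> real" where
  "dphi \<theta> t = dpsi t - \<theta> * dpsi (- t)"

lemma phi_has_derivative: "(phi \<theta> has_real_derivative dphi \<theta> t) (at t)"
proof -
  have "((\<lambda>t. psi (- t)) has_real_derivative dpsi (- t) * (- 1)) (at t)"
    by (rule DERIV_chain2[OF psi_has_derivative]) (auto intro!: derivative_eq_intros)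
  then have "((\<lambda>t. \<theta> * psi (- t) + psi t) has_real_derivative dphi \<theta> t) (at t)"
    unfolding dphi_def by (auto intro!: derivative_eq_intros psi_has_derivative)
  then show ?thesis unfolding phi_def[abs_def] .
qed

lemma dphi_bounds:
  assumes "0 \<le> \<theta>" "\<theta> \<le> 1"
  shows "- \<theta> \<le> dphi \<theta> t" "dphi \<theta> t \<le> 1" "\<bar>dphi \<theta> t\<bar> \<le> 1"
proof -
  have "0 \<le> \<theta> * dpsi (- t)" "\<theta> * dpsi (- t) \<le> \<theta> * 1"
    using assms dpsi_bounds[of "- t"] by (auto intro!: mult_left_le)
  then show "- \<theta> \<le> dphi \<theta> t" "dphi \<theta> t \<le> 1" "\<bar>dphi \<theta> t\<bar> \<le> 1"
    unfolding dphi_def using dpsi_bounds[of t] assms by auto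
qed

lemma dphi_lipschitz:
  assumes "0 \<le> \<theta>" "\<theta> \<le> 1"
  shows "\<bar>dphi \<theta> t' - dphi \<theta> t\<bar> \<le> 24 * \<bar>t' - t\<bar>"
proof -
  have "\<theta> * \<bar>dpsi (- t') - dpsi (- t)\<bar> \<le> 1 * (12 * \<bar>- t' - - t\<bar>)"
    using assms by (intro mult_mono dpsi_lipschitz) auto
  moreover have "\<bar>- t' - - t\<bar> = \<bar>t' - t\<bar>" by simp
  moreover have "\<bar>dphi \<theta> t' - dphi \<theta> t\<bar> \<le> \<bar>dpsi t' - dpsi t\<bar> + \<theta> * \<bar>dpsi (- t') - dpsi (- t)\<bar>"
  proof -
    have "dphi \<theta> t' - dphi \<theta> t = (dpsi t' - dpsi t) - \<theta> * (dpsi (- t') - dpsi (- t))"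
      by (simp add: dphi_def algebra_simps)
    also have "\<bar>\<dots>\<bar> \<le> \<bar>dpsi t' - dpsi t\<bar> + \<bar>\<theta> * (dpsi (- t') - dpsi (- t))\<bar>" by (rule abs_triangle_ineq4)
    finally show ?thesis using assms by (simp add: abs_mult)
  qed
  ultimately show ?thesis using dpsi_lipschitz[of t' t] by linarith
qed

section \<open>Second-order expansion of exponential increments\<close>

lemma phi_mvt:
  obtains \<xi> where "\<bar>\<xi> - t\<bar> \<le> \<bar>k\<bar>" "phi \<theta> (t + k) - phi \<theta> t = k * dphi \<theta> \<xi>"
proof -
  consider "k = 0" | "0 < k" | "k < 0" by linarith
  then show ?thesis
  proof cases
    case 1
    then show ?thesis by (intro that[of t]) auto
  next
    case 2
    then obtain \<xi> where "t < \<xi>" "\<xi> < t + k" "phi \<theta> (t + k) - phi \<theta> t = (t + k - t) * dphi \<theta> \<xi>"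
      using MVT2[of t "t + k" "phi \<theta>" "dphi \<theta>"] phi_has_derivative by auto
    then show ?thesis by (intro that[of \<xi>]) auto
  next
    case 3
    then obtain \<xi> where "t + k < \<xi>" "\<xi> < t" "phi \<theta> t - phi \<theta> (t + k) = (t - (t + k)) * dphi \<theta> \<xi>"
      using MVT2[of "t + k" t "phi \<theta>" "dphi \<theta>"] phi_has_derivative by auto
    then show ?thesis by (intro that[of \<xi>]) auto
  qed
qed

lemma exp_le_quadratic:
  fixes v :: real
  assumes "v \<le> 1"
  shows "exp v \<le> 1 + v + v\<^sup>2"
proof (cases "0 \<le> v")
  case True
  then show ?thesis using exp_bound[of v] assms by simp
next
  case False
  \<comment> \<open>For negative \<open>v\<close> the Taylor lower bound for
    \<open>exp (- v)\<close> is multiplied by the proposed bound; the product is at least 1 since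
    \<open>- v * v\<^sup>2\<close> is nonnegative.\<close>
  have "(1 + v + v\<^sup>2) * (1 + (- v) + (- v)\<^sup>2 / 2) = 1 + v\<^sup>2 / 2 + (v\<^sup>2 * v\<^sup>2) / 2 - v * v\<^sup>2 / 2"
    by (simp add: field_simps power2_eq_square)
  moreover have "v * v\<^sup>2 \<le> 0" using False by (intro mult_nonpos_nonneg) auto
  ultimately have one: "1 \<le> (1 + v + v\<^sup>2) * (1 + (- v) + (- v)\<^sup>2 / 2)"
    using zero_le_power2[of v] mult_nonneg_nonneg[OF zero_le_power2[of v] zero_le_power2[of v]]
    by linarith
  have "0 \<le> 1 + v + v\<^sup>2"
    using zero_le_power2[of "v + 1 / 2"] by (simp add: power2_eq_square algebra_simps)
  then have "(1 + v + v\<^sup>2) * (1 + (- v) + (- v)\<^sup>2 / 2) \<le> (1 + v + v\<^sup>2) * exp (- v)"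
    using False by (intro mult_left_mono exp_lower_Taylor_quadratic) auto
  with one have "1 \<le> (1 + v + v\<^sup>2) * exp (- v)" by linarith
  then show ?thesis by (simp add: exp_minus field_simps)
qed

text \<open>The term \<open>24 * c\<close> comes from moving the slope from the intermediate point
  back to \<open>t\<close>, and \<open>c\<^sup>2\<close> from the quadratic bound on the exponential
  with slopes at most 1 in modulus.\<close>

lemma exp_phi_increment:
  assumes \<theta>: "0 \<le> \<theta>" "\<theta> \<le> 1" and c: "0 \<le> c" and small: "c * \<bar>k\<bar> \<le> 1"
  shows "exp (c * (phi \<theta> (t + k) - phi \<theta> t)) - 1 \<le> c * dphi \<theta> t * k + (24 * c + c\<^sup>2) * k\<^sup>2"
proof -
  obtain \<xi> where \<xi>: "\<bar>\<xi> - t\<bar> \<le> \<bar>k\<bar>" "phi \<theta> (t + k) - phi \<theta> t = k * dphi \<theta> \<xi>"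
    by (rule phi_mvt)
  let ?v = "c * (k * dphi \<theta> \<xi>)"
  have abs_v: "\<bar>?v\<bar> \<le> c * \<bar>k\<bar>"
    using mult_left_mono[OF dphi_bounds(3)[OF \<theta>, of \<xi>], of "c * \<bar>k\<bar>"] c by (simp add: abs_mult mult.assoc)
  then have "exp ?v \<le> 1 + ?v + ?v\<^sup>2"
    using small by (intro exp_le_quadratic) linarith
  moreover have "?v\<^sup>2 \<le> c\<^sup>2 * k\<^sup>2"
    using power_mono[OF abs_v, of 2] by (simp add: power_mult_distrib)
  moreover have "?v \<le> c * dphi \<theta> t * k + 24 * c * k\<^sup>2"
  proof -
    have "k * (dphi \<theta> \<xi> - dphi \<theta> t) \<le> \<bar>k\<bar> * \<bar>dphi \<theta> \<xi> - dphi \<theta> t\<bar>"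
      by (metis abs_ge_self abs_mult)
    also have "\<dots> \<le> \<bar>k\<bar> * (24 * \<bar>k\<bar>)"
      using dphi_lipschitz[OF \<theta>, of \<xi> t] \<xi>(1) by (intro mult_left_mono) auto
    also have "\<dots> = 24 * k\<^sup>2" by (simp add: power2_eq_square)
    finally have "c * (k * (dphi \<theta> \<xi> - dphi \<theta> t)) \<le> c * (24 * k\<^sup>2)"
      using c by (rule mult_left_mono)
    then show ?thesis by (simp add: algebra_simps)
  qed
  ultimately show ?thesis unfolding \<xi>(2) by (simp add: algebra_simps)
qed

text \<open>Outside the interval from -1 to 1 the slope is exactly 1 or \<open>- \<theta>\<close>;
  the constant 1 pays for the transition zone.\<close>

lemma dphi_drift:
  assumes \<theta>: "0 \<le> \<theta>" "\<theta> \<le> 1"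
  shows "dphi \<theta> t * (- t) \<le> 1 - max 0 t - \<theta> * max 0 (- t)"
proof -
  consider "1 \<le> t" | "0 \<le> t" "t \<le> 1" | "t \<le> - 1" | "- 1 \<le> t" "t \<le> 0" by linarith
  then show ?thesis
  proof cases
    case 1
    then show ?thesis by (simp add: dphi_def dpsi_eq_one dpsi_eq_zero)
  next
    case 2
    have "0 \<le> dphi \<theta> t"
      using 2 \<theta> dpsi_bounds[of "- t"] by (simp add: dphi_def dpsi_eq_one mult_le_one)
    then have "dphi \<theta> t * (- t) \<le> 0" using 2 by (simp add: mult_nonneg_nonneg)
    then show ?thesis using 2 by simp
  next
    case 3
    then show ?thesis by (simp add: dphi_def dpsi_eq_one dpsi_eq_zero)
  next
    case 4
    have "dpsi t * (- t) \<le> 1 * 1"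
      using 4 dpsi_bounds[of t] by (intro mult_mono) auto
    then show ?thesis using 4 by (simp add: dphi_def dpsi_eq_one algebra_simps)
  qed
qed

text \<open>Queueing contributes at most \<open>M\<close> times the total excess, which the restoring drift of the
  positive coordinates absorbs because \<open>M < 1\<close>; the choice of \<open>\<theta>\<close> guarantees this when some
  \<open>\<beta> i > 1\<close>.\<close>

lemma drift_sum_le:
  fixes y q \<beta> :: "'m::finite \<Rightarrow> real"
  assumes \<theta>: "\<kappa> \<le> \<theta>" "0 \<le> \<theta>" "\<theta> \<le> 1"
    and M: "0 \<le> M" "M \<le> 1 - \<kappa>" "\<And>i. 1 - \<beta> i \<le> M" "\<And>i. \<theta> * (\<beta> i - 1) \<le> M"
    and q: "\<And>i. 0 \<le> q i" "(\<Sum>i\<in>UNIV. q i) = max 0 (\<Sum>i\<in>UNIV. y i)"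
  shows "(\<Sum>i\<in>UNIV. dphi \<theta> (y i) * (- y i + (1 - \<beta> i) * q i))
    \<le> real CARD('m) - \<kappa> * (\<Sum>i\<in>UNIV. \<bar>y i\<bar>)"
proof -
  \<comment> \<open>The sign of \<open>1 - \<beta> i\<close> decides which end of the slope range is
    worst: slope 1 when queueing slows departures, slope \<open>- \<theta>\<close> when it speeds
    them up.\<close>
  have queue: "dphi \<theta> (y i) * ((1 - \<beta> i) * q i) \<le> M * q i" for i
  proof (cases "\<beta> i \<le> 1")
    case True
    have "dphi \<theta> (y i) * ((1 - \<beta> i) * q i) \<le> 1 * ((1 - \<beta> i) * q i)"
      using True q(1) \<theta> by (intro mult_right_mono dphi_bounds) auto
    also have "\<dots> \<le> M * q i" using M(3) q(1) by (simp add: mult_right_mono)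
    finally show ?thesis .
  next
    case False
    have "dphi \<theta> (y i) * ((1 - \<beta> i) * q i) \<le> (- \<theta>) * ((1 - \<beta> i) * q i)"
      using False q(1) \<theta> by (intro mult_right_mono_neg dphi_bounds mult_nonpos_nonneg) auto
    also have "\<dots> = (\<theta> * (\<beta> i - 1)) * q i" by (simp add: algebra_simps)
    also have "\<dots> \<le> M * q i" using M(4) q(1) by (intro mult_right_mono)
    finally show ?thesis .
  qed
  have "(\<Sum>i\<in>UNIV. dphi \<theta> (y i) * (- y i + (1 - \<beta> i) * q i))
      \<le> (\<Sum>i\<in>UNIV. 1 - max 0 (y i) - \<theta> * max 0 (- y i) + M * q i)"
    using dphi_drift[OF \<theta>(2,3)] queue by (intro sum_mono) (simp only: distrib_left add_mono)
  also have "\<dots> = real CARD('m) - (\<Sum>i\<in>UNIV. max 0 (y i)) - (\<Sum>i\<in>UNIV. \<theta> * max 0 (- y i))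
      + M * max 0 (\<Sum>i\<in>UNIV. y i)"
    unfolding q(2)[symmetric] by (simp add: sum.distrib sum_subtractf sum_distrib_left)
  finally have *: "(\<Sum>i\<in>UNIV. dphi \<theta> (y i) * (- y i + (1 - \<beta> i) * q i))
      \<le> real CARD('m) - (\<Sum>i\<in>UNIV. max 0 (y i)) - (\<Sum>i\<in>UNIV. \<theta> * max 0 (- y i))
      + M * max 0 (\<Sum>i\<in>UNIV. y i)" .
  \<comment> \<open>The positive part of a sum is at most the sum of positive parts, so the positive
    coordinates keep a share \<open>\<kappa>\<close> of their restoring drift.\<close>
  have "M * max 0 (\<Sum>i\<in>UNIV. y i) \<le> (1 - \<kappa>) * (\<Sum>i\<in>UNIV. max 0 (y i))"
    using M(1,2) by (intro mult_mono) (auto intro!: sum_mono sum_nonneg)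
  moreover have "(\<Sum>i\<in>UNIV. \<kappa> * max 0 (- y i)) \<le> (\<Sum>i\<in>UNIV. \<theta> * max 0 (- y i))"
    using \<theta>(1) by (intro sum_mono mult_right_mono) auto
  ultimately have "(\<Sum>i\<in>UNIV. dphi \<theta> (y i) * (- y i + (1 - \<beta> i) * q i))
      \<le> real CARD('m) - \<kappa> * ((\<Sum>i\<in>UNIV. max 0 (y i)) + (\<Sum>i\<in>UNIV. max 0 (- y i)))"
    using * unfolding left_diff_distrib distrib_left[of \<kappa>] sum_distrib_left[of \<kappa>] by linarith
  also have "(\<Sum>i\<in>UNIV. max 0 (y i)) + (\<Sum>i\<in>UNIV. max 0 (- y i)) = (\<Sum>i\<in>UNIV. \<bar>y i\<bar>)"
    unfolding sum.distrib[symmetric] by (intro sum.cong) (auto simp: abs_if)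
  finally show ?thesis .
qed

text \<open>\<open>M\<close> is the numerator in the definition of \<open>theta\<close>, so
  \<open>theta\<close> times the largest ratio is at most \<open>M\<close>. All ratios lie between
  \<open>a / D\<close> and \<open>D / a\<close>: the lower end keeps \<open>M\<close> away from 1,
  and the upper end together with \<open>M \<ge> 1 / 2\<close> keeps \<open>theta\<close> away from
  0.\<close>

lemma theta_bounds:
  fixes u g :: "real ^ 'm"
  assumes a: "0 < a" and u: "\<And>i. a \<le> u $ i" "\<And>i. u $ i \<le> D" and g: "\<And>i. a \<le> g $ i" "\<And>i. g $ i \<le> D"
  obtains M where "0 \<le> M" "M \<le> 1 - a / (2 * D)" "\<And>i. 1 - beta u g i \<le> M"
    "\<And>i. theta u g * (beta u g i - 1) \<le> M"
    "a / (2 * D) \<le> theta u g" "0 \<le> theta u g" "theta u g \<le> 1"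
proof -
  define \<beta>0 \<beta>1 where "\<beta>0 = Min (range (beta u g))" and "\<beta>1 = Max (range (beta u g))"
  define M where "M = max (1 - \<beta>0) (1 / 2)"
  have \<theta>: "theta u g = min 1 (M / \<beta>1)"
    by (simp add: theta_def M_def \<beta>0_def \<beta>1_def)
  have D: "0 < D" "a \<le> D"
    using a u[of undefined] by linarith+
  have beta: "a / D \<le> beta u g i" "beta u g i \<le> D / a" for i
    unfolding beta_def using a D u[of i] g[of i] by (auto intro!: frac_le)
  have \<beta>: "\<beta>0 \<le> beta u g i" "beta u g i \<le> \<beta>1" for i
    by (auto simp: \<beta>0_def \<beta>1_def)
  have "\<beta>0 \<in> range (beta u g)" "\<beta>1 \<in> range (beta u g)"
    unfolding \<beta>0_def \<beta>1_def by (intro Min_in Max_in; simp)+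
  then have \<beta>01: "a / D \<le> \<beta>0" "a / D \<le> \<beta>1" "\<beta>1 \<le> D / a"
    using beta by auto
  have aD: "0 < a / D" "a / D \<le> 1" "a / (2 * D) = a / D / 2"
    using a D by (auto simp: divide_simps)
  have \<beta>1: "0 < \<beta>1" using \<beta>01 aD by linarith
  have M: "1 / 2 \<le> M" by (simp add: M_def)
  have \<theta>\<beta>: "theta u g * \<beta>1 \<le> M"
    using \<beta>1 unfolding \<theta> by (auto simp: min_def field_simps)
  have \<theta>_nonneg: "0 \<le> theta u g" using M \<beta>1 by (simp add: \<theta>)
  show ?thesis
  proof (rule that)
    show "0 \<le> M" using M by simp
    show "M \<le> 1 - a / (2 * D)"
      unfolding M_def aD(3) using \<beta>01(1) aD(1,2) by simp
    show "1 - beta u g i \<le> M" for i using \<beta>(1)[of i] by (simp add: M_def)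
    show "theta u g * (beta u g i - 1) \<le> M" for i
    proof -
      have "theta u g * (beta u g i - 1) \<le> theta u g * \<beta>1"
        using \<beta>(2)[of i] \<theta>_nonneg by (intro mult_left_mono) auto
      with \<theta>\<beta> show ?thesis by simp
    qed
    have "(1 / 2) / (D / a) \<le> M / \<beta>1"
      using M \<beta>1 \<beta>01 a D by (intro frac_le) auto
    then have "a / (2 * D) \<le> M / \<beta>1" by simp
    then show "a / (2 * D) \<le> theta u g" unfolding \<theta> using aD by simp
    show "0 \<le> theta u g" by (rule \<theta>_nonneg)
    show "theta u g \<le> 1" by (simp add: \<theta>)
  qed
qed

section \<open>The generator on the Lyapunov function\<close>

lemma lyapunov_eq:
  "lyapunov m0 u g \<eta> y = exp (\<Sum>i\<in>UNIV. \<eta> / m0 $ i * phi (theta u g) (y $ i))"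
  unfolding lyapunov_def Psi_def phi_def
  by (simp add: sum_distrib_left sum.distrib[symmetric] algebra_simps)

lemma lyapunov_shift:
  assumes y': "\<And>j. y' $ j = y $ j + (if j = i then k else 0)"
  shows "lyapunov m0 u g \<eta> y'
    = exp (\<eta> / m0 $ i * (phi (theta u g) (y $ i + k) - phi (theta u g) (y $ i))) * lyapunov m0 u g \<eta> y"
proof -
  let ?f = "\<lambda>y j. \<eta> / m0 $ j * phi (theta u g) (y $ j)"
  have "(\<Sum>j\<in>UNIV. ?f y' j) - (\<Sum>j\<in>UNIV. ?f y j)
      = (\<Sum>j\<in>UNIV. if j = i then ?f y' j - ?f y j else 0)"
    unfolding sum_subtractf[symmetric] by (intro sum.cong) (auto simp: y')
  also have "\<dots> = \<eta> / m0 $ i * (phi (theta u g) (y $ i + k) - phi (theta u g) (y $ i))"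
    by (simp add: y' right_diff_distrib)
  finally show ?thesis
    unfolding lyapunov_eq exp_add[symmetric] by (simp add: algebra_simps)
qed

text \<open>The bound involves neither the level nor \<open>theta\<close>, which later makes the
  additive constant of the drift inequality uniform in the level.\<close>

lemma lyapunov_le:
  fixes m0 :: "real ^ 'm"
  assumes \<theta>: "0 \<le> theta u g" "theta u g \<le> 1" and E: "\<And>i. 0 \<le> \<eta> / m0 $ i" "\<And>i. \<eta> / m0 $ i \<le> E"
  shows "lyapunov m0 u g \<eta> y \<le> exp (2 * E * norm1 y)"
proof -
  have phi: "phi (theta u g) t \<le> 2 * \<bar>t\<bar>" for t
  proof -
    have "theta u g * psi (- t) \<le> theta u g * \<bar>t\<bar>"
      using psi_le_abs[of "- t"] \<theta> by (intro mult_left_mono) auto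
    also have "\<dots> \<le> 1 * \<bar>t\<bar>" using \<theta> by (intro mult_right_mono) auto
    finally show ?thesis using psi_le_abs[of t] by (simp add: phi_def)
  qed
  have "\<eta> / m0 $ i * phi (theta u g) (y $ i) \<le> 2 * E * \<bar>y $ i\<bar>" for i
  proof -
    have "\<eta> / m0 $ i * phi (theta u g) (y $ i) \<le> \<eta> / m0 $ i * (2 * \<bar>y $ i\<bar>)"
      using E phi by (intro mult_left_mono) auto
    also have "\<dots> \<le> E * (2 * \<bar>y $ i\<bar>)" using E by (intro mult_right_mono) auto
    finally show ?thesis by simp
  qed
  then show ?thesis unfolding lyapunov_eq norm1_def sum_distrib_left by (simp add: sum_mono)
qed

text \<open>The shift by \<open>varrho\<close> divided by the number of classes is chosen so that
  the centering totals exactly \<open>n\<close>; hence the positive part of the coordinate sum is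
  the scaled total queue.\<close>

lemma sum_xhat:
  fixes l u :: "real ^ 'm"
  assumes "0 < n"
  shows "(\<Sum>i\<in>UNIV. xhat n l u x $ i) = (real (\<Sum>i\<in>UNIV. x $ i) - real n) / sqrt (real n)"
proof -
  have s: "sqrt (real n) > 0" "sqrt (real n) * sqrt (real n) = real n" using assms by auto
  define S where "S = (\<Sum>i\<in>UNIV. l $ i / u $ i)"
  have "(\<Sum>i\<in>UNIV. l $ i / (real n * u $ i)) = S / real n"
    unfolding S_def sum_divide_distrib by (intro sum.cong) auto
  then have "varrho n l u * sqrt (real n) = (sqrt (real n) * sqrt (real n)) * (1 - S / real n)"
    unfolding varrho_def by (simp only: mult_ac)
  also have "\<dots> = real n - S" using assms by (simp add: s(2) right_diff_distrib)
  finally have v: "varrho n l u = (real n - S) / sqrt (real n)"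
    using s(1) by (simp add: field_simps)
  have "(\<Sum>i\<in>UNIV. xhat n l u x $ i) = (real (\<Sum>i\<in>UNIV. x $ i) - S) / sqrt (real n) - varrho n l u"
    by (simp add: xhat_def S_def sum_subtractf sum_divide_distrib[symmetric])
  also have "\<dots> = (real (\<Sum>i\<in>UNIV. x $ i) - real n) / sqrt (real n)"
    unfolding v by (simp add: diff_divide_distrib)
  finally show ?thesis .
qed

text \<open>The drift supplies decay \<open>\<eta> * \<kappa>\<close>. A quarter of it pays for
  using limiting rates as weights, a quarter for the second-order terms growing with the state, and
  half remains.\<close>

lemma lyapunov_generator_le:
  fixes l u g m0 :: "real ^ 'm" and x z :: "nat ^ 'm"
  assumes n: "0 < n" and a: "0 < a"
    and u: "\<And>i. a \<le> u $ i" "\<And>i. u $ i \<le> D" and g: "\<And>i. a \<le> g $ i" "\<And>i. g $ i \<le> D"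
    and l: "\<And>i. 0 \<le> l $ i" "\<And>i. l $ i \<le> D * real n"
    and R: "\<bar>varrho n l u\<bar> \<le> R"
    and \<eta>: "0 < \<eta>" and m0: "\<And>i. 0 < m0 $ i"
    and \<epsilon>: "\<And>i. \<bar>u $ i / m0 $ i - 1\<bar> \<le> \<epsilon>" "\<epsilon> \<le> 1" "\<epsilon> * (2 + D / a) \<le> \<kappa> / 4"
    and E: "\<And>i. \<eta> / m0 $ i \<le> E" "E \<le> sqrt (real n)" "(24 * E + E\<^sup>2) * D / sqrt (real n) \<le> \<eta> * \<kappa> / 4"
    and \<kappa>: "\<kappa> = a / (2 * D)"
    and z: "z \<in> wc_actions n x"
  defines "y \<equiv> xhat n l u x"
  shows "generator l u g z (lyapunov m0 u g \<eta> \<circ> xhat n l u) x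
    \<le> lyapunov m0 u g \<eta> y *
        (\<eta> * (real CARD('m) + 2 * R)
          + (24 * E + E\<^sup>2) * (real CARD('m) * (D + D * (D / a + R))) - \<eta> * \<kappa> / 2 * norm1 y)"
proof -
  define h where "h = 1 / sqrt (real n)"
  define \<theta> where "\<theta> = theta u g"
  define c where "c i = \<eta> / m0 $ i" for i
  define C where "C = 24 * E + E\<^sup>2"
  define d where "d i = u $ i * real (z $ i) + g $ i * (real (x $ i) - real (z $ i))" for i
  define q where "q i = h * (real (x $ i) - real (z $ i))" for i
  define m where "m = real CARD('m)"
  define r where "r = varrho n l u / m"
  define V where "V = lyapunov m0 u g \<eta>"
  have "0 < CARD('m)" by simp
  then have m: "1 \<le> m" unfolding m_def by linarith
  have h: "0 < h" "h \<le> 1" "h\<^sup>2 = 1 / real n"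
    using n by (auto simp: h_def power_divide)
  have D: "0 < D" "a \<le> D" using a u[of undefined] by linarith+
  have R0: "0 \<le> R" using R by linarith
  have r: "\<bar>r\<bar> \<le> R / m" "\<bar>r\<bar> \<le> R"
  proof -
    show "\<bar>r\<bar> \<le> R / m" using R m by (simp add: r_def divide_right_mono)
    also have "\<dots> \<le> R / 1" using m R0 by (intro divide_left_mono) auto
    finally show "\<bar>r\<bar> \<le> R" by simp
  qed
  have c: "0 < c i" "c i \<le> E" "24 * c i + (c i)\<^sup>2 \<le> C" for i
  proof -
    show *: "0 < c i" "c i \<le> E" using \<eta> m0 E(1) by (auto simp: c_def)
    show "24 * c i + (c i)\<^sup>2 \<le> C" unfolding C_def using * by (intro add_mono power_mono) auto
  qed
  have "0 < E" using c[of undefined] by linarith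
  then have C: "0 \<le> C" by (simp add: C_def)
  have small: "c i * \<bar>h\<bar> \<le> 1" for i
  proof -
    have "c i \<le> sqrt (real n)" using c(2)[of i] E(2) by linarith
    then show ?thesis using n by (simp add: h_def)
  qed
  have zx: "z $ i \<le> x $ i" for i using z by (auto simp: wc_actions_def)
  have sum_z: "(\<Sum>i\<in>UNIV. z $ i) = min n (\<Sum>i\<in>UNIV. x $ i)" using z by (auto simp: wc_actions_def)
  have d_nonneg: "0 \<le> d i" for i
  proof -
    have "0 \<le> u $ i" "0 \<le> g $ i" using a u(1)[of i] g(1)[of i] by linarith+
    then show ?thesis unfolding d_def using zx[of i] by simp
  qed
  have d_le: "d i \<le> D * real (x $ i)" for i
  proof -
    have "d i \<le> D * real (z $ i) + D * (real (x $ i) - real (z $ i))"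
      unfolding d_def using zx[of i] u(2) g(2) by (intro add_mono mult_right_mono) auto
    then show ?thesis by (simp add: algebra_simps)
  qed
  have d_zero: "d i = 0" if "x $ i = 0" for i
    using d_le[of i] d_nonneg[of i] that by simp
  have hx: "h * real (x $ i) = y $ i + r + h * (l $ i / u $ i)" for i
    unfolding y_def xhat_def r_def m_def h_def by (simp add: diff_divide_distrib)
  obtain M where M: "0 \<le> M" "M \<le> 1 - \<kappa>" "\<And>i. 1 - beta u g i \<le> M"
    "\<And>i. \<theta> * (beta u g i - 1) \<le> M" and \<theta>: "\<kappa> \<le> \<theta>" "0 \<le> \<theta>" "\<theta> \<le> 1"
    using theta_bounds[OF a u g] unfolding \<theta>_def \<kappa> by metis
  have q_nonneg: "0 \<le> q i" for i using h zx[of i] by (simp add: q_def)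
  have sum_q: "(\<Sum>i\<in>UNIV. q i) = max 0 (\<Sum>i\<in>UNIV. y $ i)"
  proof -
    have "(\<Sum>i\<in>UNIV. q i) = h * (real (\<Sum>i\<in>UNIV. x $ i) - real (\<Sum>i\<in>UNIV. z $ i))"
      by (simp add: q_def sum_distrib_left[symmetric] sum_subtractf)
    also have "\<dots> = h * max 0 (real (\<Sum>i\<in>UNIV. x $ i) - real n)"
      unfolding sum_z by (auto simp: min_def max_def simp del: of_nat_sum)
    also have "\<dots> = max 0 (h * (real (\<Sum>i\<in>UNIV. x $ i) - real n))"
      using h by (auto simp: max_def mult_le_0_iff zero_le_mult_iff)
    also have "h * (real (\<Sum>i\<in>UNIV. x $ i) - real n) = (\<Sum>i\<in>UNIV. y $ i)"
      unfolding y_def sum_xhat[OF n] by (simp add: h_def)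
    finally show ?thesis .
  qed
  have sum_q_le: "(\<Sum>i\<in>UNIV. q i) \<le> norm1 y"
    unfolding sum_q norm1_def by (auto intro!: sum_mono sum_nonneg)
  let ?p = "\<lambda>i. dphi \<theta> (y $ i)"
  have p_abs: "\<bar>?p i\<bar> \<le> 1" for i by (rule dphi_bounds(3)[OF \<theta>(2,3)])
  have V_pos: "0 < V y" by (simp add: V_def lyapunov_def)

  have up: "l $ i * (V (xhat n l u (x + axis i 1)) - V y) \<le> l $ i * ((c i * ?p i * h + C * h\<^sup>2) * V y)" for i
  proof -
    have "V (xhat n l u (x + axis i 1)) = exp (c i * (phi \<theta> (y $ i + h) - phi \<theta> (y $ i))) * V y"
      unfolding V_def c_def \<theta>_def
      by (rule lyapunov_shift) (auto simp: y_def xhat_def h_def axis_def add_divide_distrib diff_divide_distrib)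
    then have "V (xhat n l u (x + axis i 1)) - V y
        = (exp (c i * (phi \<theta> (y $ i + h) - phi \<theta> (y $ i))) - 1) * V y"
      by (simp add: algebra_simps)
    also have "\<dots> \<le> (c i * ?p i * h + (24 * c i + (c i)\<^sup>2) * h\<^sup>2) * V y"
      using exp_phi_increment[OF \<theta>(2,3) _ small[of i], of "y $ i"] c(1)[of i] V_pos
      by (intro mult_right_mono) auto
    also have "\<dots> \<le> (c i * ?p i * h + C * h\<^sup>2) * V y"
      using V_pos c(3)[of i] by (intro mult_right_mono add_left_mono) auto
    finally show ?thesis using l(1) by (rule mult_left_mono)
  qed
  have down: "d i * (V (xhat n l u (x - axis i 1)) - V y) \<le> d i * ((- (c i * ?p i * h) + C * h\<^sup>2) * V y)" for i
  proof (cases "x $ i = 0")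
    case True
    then show ?thesis by (simp add: d_zero)
  next
    case False
    have "V (xhat n l u (x - axis i 1)) = exp (c i * (phi \<theta> (y $ i + - h) - phi \<theta> (y $ i))) * V y"
      unfolding V_def c_def \<theta>_def
      by (rule lyapunov_shift)
         (use False in \<open>auto simp: y_def xhat_def h_def axis_def of_nat_diff diff_divide_distrib\<close>)
    then have "V (xhat n l u (x - axis i 1)) - V y
        = (exp (c i * (phi \<theta> (y $ i + - h) - phi \<theta> (y $ i))) - 1) * V y"
      by (simp add: algebra_simps)
    also have "\<dots> \<le> (c i * ?p i * (- h) + (24 * c i + (c i)\<^sup>2) * (- h)\<^sup>2) * V y"
      using exp_phi_increment[OF \<theta>(2,3), of "c i" "- h" "y $ i"] small[of i] c(1)[of i] V_pos
      by (intro mult_right_mono) auto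
    also have "\<dots> \<le> (- (c i * ?p i * h) + C * h\<^sup>2) * V y"
      using V_pos c(3)[of i] by (intro mult_right_mono add_mono) (auto intro: mult_right_mono)
    finally show ?thesis using d_nonneg by (rule mult_left_mono)
  qed
  have "generator l u g z (V \<circ> xhat n l u) x
      = (\<Sum>i\<in>UNIV. l $ i * (V (xhat n l u (x + axis i 1)) - V y) + d i * (V (xhat n l u (x - axis i 1)) - V y))"
    by (simp add: generator_def y_def d_def sum.distrib)
  also have "\<dots> \<le> (\<Sum>i\<in>UNIV. l $ i * ((c i * ?p i * h + C * h\<^sup>2) * V y)
      + d i * ((- (c i * ?p i * h) + C * h\<^sup>2) * V y))"
    by (intro sum_mono add_mono up down)
  also have "\<dots> = V y * (\<Sum>i\<in>UNIV. c i * ?p i * (h * (l $ i - d i)) + C * (h\<^sup>2 * (l $ i + d i)))"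
    by (simp add: sum_distrib_left algebra_simps)
  finally have gen: "generator l u g z (V \<circ> xhat n l u) x
      \<le> V y * (\<Sum>i\<in>UNIV. c i * ?p i * (h * (l $ i - d i)) + C * (h\<^sup>2 * (l $ i + d i)))" .

  \<comment> \<open>With \<open>\<rho> = u $ i / m0 $ i\<close> the product of weight and service
    rate is \<open>\<eta> * \<rho>\<close>. Replacing \<open>\<rho>\<close> by 1 leaves the drift
    summed over classes, at a cost of \<open>\<epsilon>\<close> times its size; the centering shift
    costs \<open>2 * R / m\<close>.\<close>
  have first: "c i * ?p i * (h * (l $ i - d i))
      \<le> \<eta> * (?p i * (- y $ i + (1 - beta u g i) * q i))
        + \<eta> * (\<epsilon> * (\<bar>y $ i\<bar> + (1 + D / a) * q i)) + \<eta> * (2 * R / m)" for i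
  proof -
    define b where "b = beta u g i"
    define \<rho> where "\<rho> = u $ i / m0 $ i"
    have ui: "0 < u $ i" using a u(1)[of i] by linarith
    have "0 \<le> b" unfolding b_def beta_def using ui a g(1)[of i] by simp
    moreover have "b \<le> D / a" unfolding b_def beta_def
      using a D u(1)[of i] g[of i] by (intro frac_le) auto
    ultimately have b: "\<bar>1 - b\<bar> \<le> 1 + D / a" by linarith
    have \<rho>: "\<bar>\<rho> - 1\<bar> \<le> \<epsilon>" "\<bar>\<rho>\<bar> \<le> 2" using \<epsilon>(1)[of i] \<epsilon>(2) by (auto simp: \<rho>_def)
    have gi: "g $ i = u $ i * b" using ui by (simp add: b_def beta_def)
    have "h * (l $ i - d i) = u $ i * (h * (l $ i / u $ i) - h * real (x $ i) + (1 - b) * q i)"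
      unfolding d_def gi q_def using ui by (simp add: field_simps)
    also have "\<dots> = u $ i * (- y $ i - r + (1 - b) * q i)" unfolding hx by (simp add: algebra_simps)
    finally have "c i * ?p i * (h * (l $ i - d i)) = \<eta> * (\<rho> * (?p i * (- y $ i - r + (1 - b) * q i)))"
      by (simp add: c_def \<rho>_def)
    also have "\<rho> * (?p i * (- y $ i - r + (1 - b) * q i))
        = ?p i * (- y $ i + (1 - b) * q i) + (\<rho> - 1) * (?p i * (- y $ i + (1 - b) * q i)) + (- \<rho>) * (?p i * r)"
      by (simp add: algebra_simps)
    also have "\<dots> \<le> ?p i * (- y $ i + (1 - b) * q i) + \<epsilon> * (\<bar>y $ i\<bar> + (1 + D / a) * q i) + 2 * R / m"
    proof (intro add_mono order_refl)
      have "\<bar>- y $ i + (1 - b) * q i\<bar> \<le> \<bar>y $ i\<bar> + \<bar>1 - b\<bar> * q i"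
        using abs_triangle_ineq[of "- y $ i" "(1 - b) * q i"] q_nonneg[of i] by (simp add: abs_mult)
      also have "\<dots> \<le> \<bar>y $ i\<bar> + (1 + D / a) * q i"
        using b q_nonneg[of i] by (intro add_left_mono mult_right_mono)
      finally have s: "\<bar>- y $ i + (1 - b) * q i\<bar> \<le> \<bar>y $ i\<bar> + (1 + D / a) * q i" .
      have "\<bar>?p i * (- y $ i + (1 - b) * q i)\<bar> \<le> 1 * (\<bar>y $ i\<bar> + (1 + D / a) * q i)"
        unfolding abs_mult by (intro mult_mono p_abs s) auto
      then have "\<bar>(\<rho> - 1) * (?p i * (- y $ i + (1 - b) * q i))\<bar> \<le> \<epsilon> * (\<bar>y $ i\<bar> + (1 + D / a) * q i)"
        unfolding abs_mult[of "\<rho> - 1"] using \<rho>(1) by (intro mult_mono) auto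
      then show "(\<rho> - 1) * (?p i * (- y $ i + (1 - b) * q i)) \<le> \<epsilon> * (\<bar>y $ i\<bar> + (1 + D / a) * q i)"
        by linarith
      have "\<bar>?p i * r\<bar> \<le> 1 * (R / m)"
        unfolding abs_mult using p_abs r(1) by (intro mult_mono) auto
      then have "\<bar>(- \<rho>) * (?p i * r)\<bar> \<le> 2 * (R / m)"
        unfolding abs_mult[of "- \<rho>"] using \<rho>(2) by (intro mult_mono) auto
      then show "(- \<rho>) * (?p i * r) \<le> 2 * R / m" by linarith
    qed
    finally show ?thesis using \<eta> by (simp add: b_def distrib_left)
  qed
  have sum_first: "(\<Sum>i\<in>UNIV. c i * ?p i * (h * (l $ i - d i)))
      \<le> \<eta> * (m + 2 * R) - \<eta> * (3 / 4 * \<kappa>) * norm1 y"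
  proof -
    have "(\<Sum>i\<in>UNIV. c i * ?p i * (h * (l $ i - d i)))
        \<le> (\<Sum>i\<in>UNIV. \<eta> * (?p i * (- y $ i + (1 - beta u g i) * q i))
          + \<eta> * (\<epsilon> * (\<bar>y $ i\<bar> + (1 + D / a) * q i)) + \<eta> * (2 * R / m))"
      by (intro sum_mono first)
    also have "\<dots> = \<eta> * (\<Sum>i\<in>UNIV. ?p i * (- y $ i + (1 - beta u g i) * q i))
        + \<eta> * (\<epsilon> * (norm1 y + (1 + D / a) * (\<Sum>i\<in>UNIV. q i))) + \<eta> * (2 * R)"
      using m by (simp add: sum.distrib sum_distrib_left[symmetric] norm1_def m_def)
    also have "\<dots> \<le> \<eta> * (m - \<kappa> * norm1 y) + \<eta> * (\<kappa> / 4 * norm1 y) + \<eta> * (2 * R)"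
    proof (intro add_mono mult_left_mono order_refl)
      show "(\<Sum>i\<in>UNIV. ?p i * (- y $ i + (1 - beta u g i) * q i)) \<le> m - \<kappa> * norm1 y"
        unfolding m_def norm1_def by (rule drift_sum_le[OF \<theta> M q_nonneg sum_q])
      have \<epsilon>0: "0 \<le> \<epsilon>" using \<epsilon>(1)[of undefined] by linarith
      have "norm1 y + (1 + D / a) * (\<Sum>i\<in>UNIV. q i) \<le> norm1 y + (1 + D / a) * norm1 y"
        using a D sum_q_le by (intro add_left_mono mult_left_mono) auto
      then have "\<epsilon> * (norm1 y + (1 + D / a) * (\<Sum>i\<in>UNIV. q i)) \<le> \<epsilon> * (norm1 y + (1 + D / a) * norm1 y)"
        using \<epsilon>0 by (rule mult_left_mono)
      also have "\<dots> = \<epsilon> * (2 + D / a) * norm1 y" by (simp add: algebra_simps)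
      also have "\<dots> \<le> \<kappa> / 4 * norm1 y"
        using \<epsilon>(3) by (intro mult_right_mono) (auto simp: norm1_def sum_nonneg)
      finally show "\<epsilon> * (norm1 y + (1 + D / a) * (\<Sum>i\<in>UNIV. q i)) \<le> \<kappa> / 4 * norm1 y" .
    qed (use \<eta> in auto)
    also have "\<dots> = \<eta> * (m + 2 * R) - \<eta> * (3 / 4 * \<kappa>) * norm1 y" by (simp add: algebra_simps)
    finally show ?thesis .
  qed
  \<comment> \<open>Jump rates are of order \<open>n\<close> plus \<open>sqrt n\<close> times the
    scaled state. After multiplication by \<open>h\<^sup>2\<close> this is a constant plus a linear
    term with the vanishing factor \<open>h\<close>.\<close>
  have second: "h\<^sup>2 * (l $ i + d i) \<le> D + D * (D / a + R) + D * h * \<bar>y $ i\<bar>" for i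
  proof -
    have hl: "h\<^sup>2 * l $ i \<le> D" using l(2)[of i] n by (simp add: h(3) field_simps)
    have "h\<^sup>2 * (l $ i / u $ i) = (h\<^sup>2 * l $ i) / u $ i" by simp
    also have "\<dots> \<le> D / a" using hl a u(1)[of i] D by (intro frac_le) auto
    finally have lu: "h\<^sup>2 * (l $ i / u $ i) \<le> D / a" .
    have "h * r \<le> h * \<bar>r\<bar>" using h by (intro mult_left_mono) auto
    also have "\<dots> \<le> 1 * R" using r(2) h by (intro mult_mono) auto
    finally have hr: "h * r \<le> R" by simp
    have "h * y $ i \<le> h * \<bar>y $ i\<bar>" using h by (intro mult_left_mono) auto
    moreover have "h\<^sup>2 * real (x $ i) = h * y $ i + h * r + h\<^sup>2 * (l $ i / u $ i)"
      using arg_cong[OF hx[of i], of "\<lambda>t. h * t"] by (simp add: power2_eq_square distrib_left mult.assoc)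
    ultimately have "h\<^sup>2 * real (x $ i) \<le> h * \<bar>y $ i\<bar> + R + D / a"
      using lu hr by linarith
    then have "D * (h\<^sup>2 * real (x $ i)) \<le> D * (h * \<bar>y $ i\<bar> + R + D / a)"
      using D by (intro mult_left_mono) auto
    moreover have "h\<^sup>2 * d i \<le> h\<^sup>2 * (D * real (x $ i))" by (intro mult_left_mono d_le) simp
    moreover have "h\<^sup>2 * (D * real (x $ i)) = D * (h\<^sup>2 * real (x $ i))" by simp
    ultimately have "h\<^sup>2 * d i \<le> D * (h * \<bar>y $ i\<bar> + R + D / a)" by linarith
    then show ?thesis using hl by (simp add: algebra_simps)
  qed
  have "(\<Sum>i\<in>UNIV. C * (h\<^sup>2 * (l $ i + d i)))
      \<le> (\<Sum>i\<in>UNIV. C * (D + D * (D / a + R) + D * h * \<bar>y $ i\<bar>))"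
    by (intro sum_mono mult_left_mono second C)
  also have "\<dots> = C * (m * (D + D * (D / a + R))) + (C * D * h) * norm1 y"
    by (simp add: norm1_def m_def sum_distrib_left[symmetric] sum.distrib distrib_left mult_ac)
  also have "\<dots> \<le> C * (m * (D + D * (D / a + R))) + \<eta> * \<kappa> / 4 * norm1 y"
    using E(3) by (intro add_left_mono mult_right_mono) (auto simp: C_def h_def norm1_def sum_nonneg)
  finally have "(\<Sum>i\<in>UNIV. c i * ?p i * (h * (l $ i - d i)) + C * (h\<^sup>2 * (l $ i + d i)))
      \<le> \<eta> * (m + 2 * R) + C * (m * (D + D * (D / a + R))) - \<eta> * \<kappa> / 2 * norm1 y"
    using sum_first by (simp add: sum.distrib)
  then have "V y * (\<Sum>i\<in>UNIV. c i * ?p i * (h * (l $ i - d i)) + C * (h\<^sup>2 * (l $ i + d i)))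
      \<le> V y * (\<eta> * (m + 2 * R) + C * (m * (D + D * (D / a + R))) - \<eta> * \<kappa> / 2 * norm1 y)"
    using V_pos by (intro mult_left_mono) auto
  with gen show ?thesis unfolding V_def m_def C_def by linarith
qed

section \<open>Uniformity in the level\<close>

text \<open>Half of the decay outweighs \<open>A\<close> once \<open>s\<close> exceeds
  \<open>2 * A / k\<close>; below that point the growth bound on \<open>V\<close> caps what remains
  by a constant.\<close>

lemma drift_absorb:
  fixes V :: real
  assumes V: "0 < V" "V \<le> exp (b * s)" and b: "0 \<le> b" and s: "0 \<le> s" and A: "0 \<le> A" and k: "0 < k"
  shows "V * (A - k * s) \<le> A * exp (b * (2 * A / k)) - k / 2 * s * V"
proof -
  have "V * (A - k / 2 * s) \<le> A * exp (b * (2 * A / k))"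
  proof (cases "s \<le> 2 * A / k")
    case True
    have "V \<le> exp (b * (2 * A / k))"
      using V(2) mult_left_mono[OF True b] by (meson exp_le_cancel_iff order_trans)
    then have "A * V \<le> A * exp (b * (2 * A / k))" using A by (rule mult_left_mono)
    moreover have "V * (A - k / 2 * s) \<le> V * A" using V(1) k s by (intro mult_left_mono) auto
    ultimately show ?thesis by (simp add: mult.commute)
  next
    case False
    then have "A - k / 2 * s \<le> 0" using k by (simp add: field_simps)
    then have "V * (A - k / 2 * s) \<le> 0" using V(1) by (intro mult_nonneg_nonpos) auto
    also have "0 \<le> A * exp (b * (2 * A / k))" using A by simp
    finally show ?thesis .
  qed
  then show ?thesis by (simp add: algebra_simps)
qed

text \<open>Critical load replaces the 1 in \<open>varrho\<close> by the sum of limiting loads, so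
  only scaled deviations of the rates from their limits remain, and these converge by
  hypothesis.\<close>

lemma varrho_convergent:
  fixes lam mu :: "nat \<Rightarrow> real ^ 'm"
  assumes mu_pos: "\<And>n i. 0 < n \<Longrightarrow> 0 < mu n $ i"
    and mu0_pos: "\<And>i. 0 < mu0 $ i"
    and mu_lim: "\<And>i. (\<lambda>n. mu n $ i) \<longlonglongrightarrow> mu0 $ i"
    and lam_diff: "\<And>i. convergent (\<lambda>n. (lam n $ i - real n * lam0 $ i) / sqrt (real n))"
    and mu_diff: "\<And>i. convergent (\<lambda>n. sqrt (real n) * (mu n $ i - mu0 $ i))"
    and load: "(\<Sum>i\<in>UNIV. lam0 $ i / mu0 $ i) = 1"
  shows "convergent (\<lambda>n. varrho n (lam n) (mu n))"
proof -
  define f where "f n i = lam0 $ i / mu0 $ i * (sqrt (real n) * (mu n $ i - mu0 $ i)) / mu n $ i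
      - (lam n $ i - real n * lam0 $ i) / sqrt (real n) / mu n $ i" for n i
  have "varrho n (lam n) (mu n) = (\<Sum>i\<in>UNIV. f n i)" if n: "0 < n" for n
  proof -
    have "varrho n (lam n) (mu n)
        = (\<Sum>i\<in>UNIV. sqrt (real n) * (lam0 $ i / mu0 $ i - lam n $ i / (real n * mu n $ i)))"
      unfolding varrho_def load[symmetric] sum_subtractf[symmetric] sum_distrib_left ..
    also have "\<dots> = (\<Sum>i\<in>UNIV. f n i)"
    proof (intro sum.cong refl)
      fix i
      define s where "s = sqrt (real n)"
      have s: "s \<noteq> 0" "real n = s * s" using n by (auto simp: s_def)
      show "sqrt (real n) * (lam0 $ i / mu0 $ i - lam n $ i / (real n * mu n $ i)) = f n i"
        unfolding f_def s_def[symmetric] s(2) using s(1) mu_pos[OF n, of i] mu0_pos[of i]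
        by (simp add: field_simps)
    qed
    finally show ?thesis .
  qed
  then have ev: "\<forall>\<^sub>F n in sequentially. (\<Sum>i\<in>UNIV. f n i) = varrho n (lam n) (mu n)"
    by (intro eventually_sequentiallyI[of 1]) auto
  obtain A where A: "\<And>i. (\<lambda>n. (lam n $ i - real n * lam0 $ i) / sqrt (real n)) \<longlonglongrightarrow> A i"
    using lam_diff unfolding convergent_def by metis
  obtain B where B: "\<And>i. (\<lambda>n. sqrt (real n) * (mu n $ i - mu0 $ i)) \<longlonglongrightarrow> B i"
    using mu_diff unfolding convergent_def by metis
  have mu0_ne: "mu0 $ i \<noteq> 0" for i using mu0_pos[of i] by simp
  have "(\<lambda>n. \<Sum>i\<in>UNIV. f n i)
      \<longlonglongrightarrow> (\<Sum>i\<in>UNIV. lam0 $ i / mu0 $ i * B i / mu0 $ i - A i / mu0 $ i)"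
    unfolding f_def by (intro tendsto_sum tendsto_diff tendsto_divide tendsto_mult_left A B mu_lim mu0_ne)
  then show ?thesis
    using Lim_transform_eventually[OF _ ev] unfolding convergent_def by blast
qed

theorem theorem3p4:
  fixes lam mu gam :: "nat \<Rightarrow> real ^ 'm"
    and lam0 mu0 gam0 rho :: "real ^ 'm"
  assumes lam_nonneg: "\<And>n i. 0 < n \<Longrightarrow> 0 \<le> lam n $ i"
    and mu_pos: "\<And>n i. 0 < n \<Longrightarrow> 0 < mu n $ i"
    and gam_nonneg: "\<And>n i. 0 < n \<Longrightarrow> 0 \<le> gam n $ i"
    and lam0_pos: "\<And>i. 0 < lam0 $ i"
    and mu0_pos: "\<And>i. 0 < mu0 $ i"
    and gam0_nonneg: "\<And>i. 0 \<le> gam0 $ i"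
    and lam_lim: "\<And>i. (\<lambda>n. lam n $ i / real n) \<longlonglongrightarrow> lam0 $ i"
    and mu_lim: "\<And>i. (\<lambda>n. mu n $ i) \<longlonglongrightarrow> mu0 $ i"
    and gam_lim: "\<And>i. (\<lambda>n. gam n $ i) \<longlonglongrightarrow> gam0 $ i"
    and lam_diff: "\<And>i. convergent (\<lambda>n. (lam n $ i - real n * lam0 $ i) / sqrt (real n))"
    and mu_diff: "\<And>i. convergent (\<lambda>n. sqrt (real n) * (mu n $ i - mu0 $ i))"
    and rho_def: "\<And>i. rho $ i = lam0 $ i / mu0 $ i"
    and rho_lim: "\<And>i. (\<lambda>n. lam n $ i / (real n * mu n $ i)) \<longlonglongrightarrow> rho $ i"
    and rho_less: "\<And>i. rho $ i < 1"
    and rho_sum: "(\<Sum>i\<in>UNIV. rho $ i) = 1"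
    and gam_liminf: "\<And>i. 0 < liminf (\<lambda>n. ereal (gam n $ i))"
  shows
    "(\<forall>\<eta>>0. \<exists>\<kappa>\<^sub>0>0. \<exists>\<kappa>\<^sub>1>0. \<forall>\<^sub>F n in sequentially.
        \<forall>y\<in>scaled_states n (lam n) (mu n). \<forall>z\<in>scaled_wc_actions n (lam n) (mu n) y.
          scaled_generator n (lam n) (mu n) (gam n) z (lyapunov mu0 (mu n) (gam n) \<eta>) y
            \<le> \<kappa>\<^sub>0 - \<kappa>\<^sub>1 * norm1 y * lyapunov mu0 (mu n) (gam n) \<eta> y) \<and>
     (\<forall>\<^sub>F n in sequentially. \<forall>z. wc_policy n z \<longrightarrow>
        (\<exists>!\<pi>. stationary (policy_rates (lam n) (mu n) (gam n) z) \<pi>) \<and>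
        (\<forall>\<pi>. stationary (policy_rates (lam n) (mu n) (gam n) z) \<pi> \<longrightarrow>
          (\<forall>\<eta>>0. integrable (measure_pmf (map_pmf (xhat n (lam n) (mu n)) \<pi>))
                    (\<lambda>y. exp (\<eta> * norm1 y)))))"
proof -
  have gam0_pos: "0 < gam0 $ i" for i
  proof -
    have "liminf (\<lambda>n. ereal (gam n $ i)) = ereal (gam0 $ i)"
      by (intro lim_imp_Liminf tendsto_ereal gam_lim) simp
    then show ?thesis using gam_liminf[of i] by simp
  qed
  \<comment> \<open>Halving the minimum and adding 1 to the maximum leave a strict margin to the
    limits, so the bounds hold at all large levels.\<close>
  define a where "a = Min (range (\<lambda>i. min (mu0 $ i) (gam0 $ i))) / 2"
  define D where "D = Max (range (\<lambda>i. max (lam0 $ i) (max (mu0 $ i) (gam0 $ i)))) + 1"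
  have "Min (range (\<lambda>i. min (mu0 $ i) (gam0 $ i))) \<in> range (\<lambda>i. min (mu0 $ i) (gam0 $ i))"
    by (intro Min_in) auto
  then have a_pos: "0 < a" using mu0_pos gam0_pos by (auto simp: a_def)
  have a_less: "a < mu0 $ i" "a < gam0 $ i" for i
  proof -
    have "Min (range (\<lambda>i. min (mu0 $ i) (gam0 $ i))) \<le> min (mu0 $ i) (gam0 $ i)"
      by (rule Min_le) auto
    then have "2 * a \<le> min (mu0 $ i) (gam0 $ i)" by (simp add: a_def)
    then show "a < mu0 $ i" "a < gam0 $ i" using a_pos by auto
  qed
  have less_D: "lam0 $ i < D" "mu0 $ i < D" "gam0 $ i < D" for i
  proof -
    have "max (lam0 $ i) (max (mu0 $ i) (gam0 $ i))
        \<le> Max (range (\<lambda>i. max (lam0 $ i) (max (mu0 $ i) (gam0 $ i))))"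
      by (rule Max_ge) auto
    then have "max (lam0 $ i) (max (mu0 $ i) (gam0 $ i)) \<le> D - 1" unfolding D_def by linarith
    then show "lam0 $ i < D" "mu0 $ i < D" "gam0 $ i < D" by auto
  qed
  have D_pos: "0 < D" using less_D(2)[of undefined] mu0_pos[of undefined] by linarith
  have rates: "\<forall>\<^sub>F n in sequentially. 0 < n \<and> (\<forall>i. a \<le> mu n $ i \<and> mu n $ i \<le> D \<and> a \<le> gam n $ i
      \<and> gam n $ i \<le> D \<and> lam n $ i \<le> D * real n)"
  proof (intro eventually_conj eventually_all_finite)
    show pos: "\<forall>\<^sub>F n in sequentially. 0 < (n::nat)" by (rule eventually_gt_at_top)
    fix i
    show "\<forall>\<^sub>F n in sequentially. a \<le> mu n $ i"
      by (rule eventually_mono[OF order_tendstoD(1)[OF mu_lim a_less(1), of i]]) simp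
    show "\<forall>\<^sub>F n in sequentially. mu n $ i \<le> D"
      by (rule eventually_mono[OF order_tendstoD(2)[OF mu_lim less_D(2), of i]]) simp
    show "\<forall>\<^sub>F n in sequentially. a \<le> gam n $ i"
      by (rule eventually_mono[OF order_tendstoD(1)[OF gam_lim a_less(2), of i]]) simp
    show "\<forall>\<^sub>F n in sequentially. gam n $ i \<le> D"
      by (rule eventually_mono[OF order_tendstoD(2)[OF gam_lim less_D(3), of i]]) simp
    show "\<forall>\<^sub>F n in sequentially. lam n $ i \<le> D * real n"
      using order_tendstoD(2)[OF lam_lim less_D(1), of i] pos
      by eventually_elim (simp add: field_simps)
  qed
  have "convergent (\<lambda>n. varrho n (lam n) (mu n))"
    using mu_pos mu0_pos mu_lim lam_diff mu_diff rho_sum unfolding rho_def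
    by (intro varrho_convergent)
  then obtain R where R: "\<And>n. \<bar>varrho n (lam n) (mu n)\<bar> \<le> R"
    using convergent_imp_Bseq by (metis Bseq_def real_norm_def)
  have "\<exists>\<kappa>\<^sub>0>0. \<exists>\<kappa>\<^sub>1>0. \<forall>\<^sub>F n in sequentially.
        \<forall>y\<in>scaled_states n (lam n) (mu n). \<forall>z\<in>scaled_wc_actions n (lam n) (mu n) y.
          scaled_generator n (lam n) (mu n) (gam n) z (lyapunov mu0 (mu n) (gam n) \<eta>) y
            \<le> \<kappa>\<^sub>0 - \<kappa>\<^sub>1 * norm1 y * lyapunov mu0 (mu n) (gam n) \<eta> y" if \<eta>: "0 < \<eta>" for \<eta>
  proof -
    define \<kappa> where "\<kappa> = a / (2 * D)"
    \<comment> \<open>The sum dominates each of its nonnegative terms, so it serves as a common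
      bound on the weights.\<close>
    define E where "E = (\<Sum>i\<in>UNIV. \<eta> / mu0 $ i)"
    define \<epsilon> where "\<epsilon> = min 1 (\<kappa> / 4 / (2 + D / a))"
    define A where "A = \<eta> * (real CARD('m) + 2 * R)
      + (24 * E + E\<^sup>2) * (real CARD('m) * (D + D * (D / a + R)))"
    have \<kappa>_pos: "0 < \<kappa>" using a_pos D_pos by (simp add: \<kappa>_def)
    have quot_pos: "0 < 2 + D / a" using a_pos D_pos by (simp add: add_pos_pos)
    have \<epsilon>_pos: "0 < \<epsilon>" using \<kappa>_pos quot_pos by (simp add: \<epsilon>_def)
    have "\<epsilon> \<le> \<kappa> / 4 / (2 + D / a)" by (simp add: \<epsilon>_def)
    then have \<epsilon>_le: "\<epsilon> * (2 + D / a) \<le> \<kappa> / 4" using quot_pos by (simp only: pos_le_divide_eq)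
    have c_nonneg: "0 \<le> \<eta> / mu0 $ i" for i using \<eta> mu0_pos[of i] by simp
    have c_le: "\<eta> / mu0 $ i \<le> E" for i
      unfolding E_def using c_nonneg by (intro member_le_sum) auto
    have E_nonneg: "0 \<le> E" unfolding E_def by (intro sum_nonneg c_nonneg)
    have R_nonneg: "0 \<le> R" using R[of 0] by linarith
    have "0 < \<eta> * (real CARD('m) + 2 * R)" using \<eta> R_nonneg by (simp add: add_pos_nonneg)
    then have A_pos: "0 < A"
      unfolding A_def using E_nonneg D_pos a_pos R_nonneg by (intro add_pos_nonneg) auto
    have sqrt_lim: "filterlim (\<lambda>n. sqrt (real n)) at_top sequentially"
      by (rule filterlim_compose[OF sqrt_at_top filterlim_real_sequentially])
    have ev_E: "\<forall>\<^sub>F n in sequentially. E \<le> sqrt (real n)"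
      using sqrt_lim by (simp add: filterlim_at_top)
    have "(\<lambda>n. (24 * E + E\<^sup>2) * D / sqrt (real n)) \<longlonglongrightarrow> 0"
      by (rule real_tendsto_divide_at_top[OF tendsto_const sqrt_lim])
    then have ev_small: "\<forall>\<^sub>F n in sequentially. (24 * E + E\<^sup>2) * D / sqrt (real n) < \<eta> * \<kappa> / 4"
      using \<eta> \<kappa>_pos by (intro order_tendstoD(2)) auto
    have ev_ratio: "\<forall>\<^sub>F n in sequentially. \<forall>i. \<bar>mu n $ i / mu0 $ i - 1\<bar> \<le> \<epsilon>"
    proof (rule eventually_all_finite)
      fix i
      have "(\<lambda>n. \<bar>mu n $ i / mu0 $ i - 1\<bar>) \<longlonglongrightarrow> \<bar>mu0 $ i / mu0 $ i - 1\<bar>"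
        using mu0_pos[of i] by (intro tendsto_intros mu_lim) auto
      then have "(\<lambda>n. \<bar>mu n $ i / mu0 $ i - 1\<bar>) \<longlonglongrightarrow> 0"
        using mu0_pos[of i] by simp
      from order_tendstoD(2)[OF this \<epsilon>_pos]
      show "\<forall>\<^sub>F n in sequentially. \<bar>mu n $ i / mu0 $ i - 1\<bar> \<le> \<epsilon>"
        by (rule eventually_mono) simp
    qed
    define k where "k = \<eta> * \<kappa> / 2"
    have k: "0 < k" using \<eta> \<kappa>_pos by (simp add: k_def)
    show ?thesis
    proof (intro exI conjI)
      \<comment> \<open>Both constants are those returned by \<open>drift_absorb\<close> with growth
        exponent \<open>2 * E\<close> from \<open>lyapunov_le\<close>.\<close>
      show "0 < A * exp (2 * E * (2 * A / k))" using A_pos by simp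
      show "0 < k / 2" using k by simp
      show "\<forall>\<^sub>F n in sequentially.
        \<forall>y\<in>scaled_states n (lam n) (mu n). \<forall>z\<in>scaled_wc_actions n (lam n) (mu n) y.
          scaled_generator n (lam n) (mu n) (gam n) z (lyapunov mu0 (mu n) (gam n) \<eta>) y
            \<le> A * exp (2 * E * (2 * A / k)) - k / 2 * norm1 y * lyapunov mu0 (mu n) (gam n) \<eta> y"
        using rates ev_E ev_small ev_ratio
      proof eventually_elim
        case (elim n)
        then have n: "0 < n" by blast
        have bounds: "a \<le> mu n $ i" "mu n $ i \<le> D" "a \<le> gam n $ i" "gam n $ i \<le> D"
          "lam n $ i \<le> D * real n" for i using elim(1) by auto
        show ?case
        proof (intro ballI)
          fix y z assume y: "y \<in> scaled_states n (lam n) (mu n)"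
            and z: "z \<in> scaled_wc_actions n (lam n) (mu n) y"
          obtain x where x: "y = xhat n (lam n) (mu n) x" using y by (auto simp: scaled_states_def)
          have zx: "z \<in> wc_actions n x" using z n by (simp add: x scaled_wc_actions_xhat)
          let ?V = "lyapunov mu0 (mu n) (gam n) \<eta>"
          have "generator (lam n) (mu n) (gam n) z (?V \<circ> xhat n (lam n) (mu n)) x \<le> ?V y * (A - k * norm1 y)"
            unfolding A_def k_def x
            by (rule lyapunov_generator_le[where a = a and D = D and \<epsilon> = \<epsilon> and \<kappa> = \<kappa>])
               (use n a_pos bounds lam_nonneg[OF n] R \<eta> mu0_pos elim \<epsilon>_le c_le zx
                 in \<open>auto simp: \<epsilon>_def \<kappa>_def\<close>)
          also have "?V y * (A - k * norm1 y) \<le> A * exp (2 * E * (2 * A / k)) - k / 2 * norm1 y * ?V y"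
          proof (rule drift_absorb)
            have "0 \<le> theta (mu n) (gam n)" "theta (mu n) (gam n) \<le> 1"
              using theta_bounds[OF a_pos, of "mu n" D "gam n"] bounds by metis+
            then show "?V y \<le> exp (2 * E * norm1 y)"
              using c_nonneg c_le by (rule lyapunov_le)
            show "0 < ?V y" by (simp add: lyapunov_def)
            show "0 \<le> norm1 y" by (simp add: norm1_def sum_nonneg)
          qed (use E_nonneg A_pos k in auto)
          finally show "scaled_generator n (lam n) (mu n) (gam n) z ?V y
              \<le> A * exp (2 * E * (2 * A / k)) - k / 2 * norm1 y * ?V y"
            using n by (simp add: x scaled_generator_xhat)
        qed
      qed
    qed
  qed
  \<comment> \<open>The event \<open>rates\<close> involves neither \<eta> nor the policy, so a
    single threshold covers all of them.\<close>
  moreover have "\<forall>\<^sub>F n in sequentially. \<forall>z. wc_policy n z \<longrightarrow>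
        (\<exists>!\<pi>. stationary (policy_rates (lam n) (mu n) (gam n) z) \<pi>) \<and>
        (\<forall>\<pi>. stationary (policy_rates (lam n) (mu n) (gam n) z) \<pi> \<longrightarrow>
          (\<forall>\<eta>>0. integrable (measure_pmf (map_pmf (xhat n (lam n) (mu n)) \<pi>))
                    (\<lambda>y. exp (\<eta> * norm1 y))))"
    using rates
  proof (rule eventually_mono, intro allI impI)
    fix n and z :: "nat ^ 'm \<Rightarrow> nat ^ 'm"
    assume n: "0 < n \<and> (\<forall>i. a \<le> mu n $ i \<and> mu n $ i \<le> D \<and> a \<le> gam n $ i
      \<and> gam n $ i \<le> D \<and> lam n $ i \<le> D * real n)" and z: "wc_policy n z"
    interpret queue_rates n "lam n" "mu n" "gam n" z a D
      by unfold_locales (use n z a_pos lam_nonneg in auto)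
    show "(\<exists>!\<pi>. stationary (policy_rates (lam n) (mu n) (gam n) z) \<pi>) \<and>
        (\<forall>\<pi>. stationary (policy_rates (lam n) (mu n) (gam n) z) \<pi> \<longrightarrow>
          (\<forall>\<eta>>0. integrable (measure_pmf (map_pmf (xhat n (lam n) (mu n)) \<pi>))
                    (\<lambda>y. exp (\<eta> * norm1 y))))"
      using stationary_exists_unique stationary_exp_norm1_integrable n by blast
  qed
  ultimately show ?thesis by blast
qed

end
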